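(* Let $L\ge 2$, let $\kappa=(\kappa_1,\ldots,\kappa_L)$ be any sequence of positive integers, and put $n=\kappa_1+\cdots+\kappa_L$ and $\kappa_{\min}=\min\{\kappa_1,\ldots,\kappa_L\}$. Then the log-Sobolev constant $\tau_{\mathrm{LS}}(\kappa)$ of the transposition walk on the multislice $\Omega_\kappa$ satisfies $$\log\left(\frac{n}{\kappa_{\min}}\right)\ \le\ \tau_{\mathrm{LS}}(\kappa)\ \le\ \frac{4}{\log 2}\,\log\left(\frac{n}{\kappa_{\min}}\right).$$
   Context: All logarithms are natural. For $\kappa=(\kappa_1,\ldots,\kappa_L)$ with $n=\sum_\ell\kappa_\ell$, the multislice is $\Omega_\kappa=\{\omega\in\{1,\ldots,L\}^n:\ \#\{i:\omega_i=\ell\}=\kappa_\ell\text{ for each }\ell\}$, equipped with the uniform probability distribution, whose expectation is denoted $\mathbb{E}_\kappa$. For $1\le i<j\le n$ and $\omega\in\Omega_\kappa$, $\omega^{ij}$ denotes $\omega$ with its $i$-th and $j$-th coordinates swapped, and $(\nabla^{ij}f)(\omega)=f(\omega^{ij})-f(\omega)$. The Dirichlet form is, for $f,g:\Omega_\kappa\to\mathbb{R}$, $$\mathcal{E}_\kappa(f,g)=\frac{1}{2n}\sum_{1\le i<j\le n}\mathbb{E}_\kappa\left[(\nabla^{ij}f)(\nabla^{ij}g)\right].$$ For $f:\Omega_\kappa\to[0,\infty)$, the entropy is $\mathrm{Ent}_\kappa(f)=\mathbb{E}_\kappa[f\log f]-\mathbb{E}_\kappa[f]\log\mathbb{E}_\kappa[f]$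 with $0\log 0=0$. The constant $\tau_{\mathrm{LS}}(\kappa)$ is the smallest $\tau\ge 0$ such that $\mathrm{Ent}_\kappa(f)\le\tau\,\mathcal{E}_\kappa(\sqrt f,\sqrt f)$ for all $f:\Omega_\kappa\to[0,\infty)$. *)

theory Defs
  imports "HOL-Probability.Probability"
begin

text \<open>
  A composition \<open>\<kappa> = (\<kappa>\<^sub>1, \<dots>, \<kappa>\<^sub>L)\<close> is given by its length \<open>L\<close> and a function
  \<open>\<kappa> :: nat \<Rightarrow> nat\<close>, of which only the values on \<open>{1..L}\<close> matter.
\<close>

definition msize :: "nat \<Rightarrow> (nat \<Rightarrow> nat) \<Rightarrow> nat" where
  "msize L \<kappa> = (\<Sum>l=1..L. \<kappa> l)"

definition kmin :: "nat \<Rightarrow> (nat \<Rightarrow> nat) \<Rightarrow> nat" where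
  "kmin L \<kappa> = Min (\<kappa> ` {1..L})"

text \<open>
  Configurations are extensional functions on \<open>{1..n}\<close> (they equal \<open>undefined\<close> elsewhere),
  so that distinct elements of the multislice are distinct words.
\<close>

definition multislice :: "nat \<Rightarrow> (nat \<Rightarrow> nat) \<Rightarrow> (nat \<Rightarrow> nat) set" where
  "multislice L \<kappa> = {\<omega> \<in> {1..msize L \<kappa>} \<rightarrow>\<^sub>E {1..L}.
     \<forall>l\<in>{1..L}. card {i \<in> {1..msize L \<kappa>}. \<omega> i = l} = \<kappa> l}"

definition expect :: "nat \<Rightarrow> (nat \<Rightarrow> nat) \<Rightarrow> ((nat \<Rightarrow> nat) \<Rightarrow> real) \<Rightarrow> real" where
  "expect L \<kappa> f = measure_pmf.expectation (pmf_of_set (multislice L \<kappa>)) f"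

definition swap_coords :: "nat \<Rightarrow> nat \<Rightarrow> (nat \<Rightarrow> nat) \<Rightarrow> (nat \<Rightarrow> nat)" where
  "swap_coords i j \<omega> = \<omega> \<circ> Transposition.transpose i j"

definition grad :: "nat \<Rightarrow> nat \<Rightarrow> ((nat \<Rightarrow> nat) \<Rightarrow> real) \<Rightarrow> (nat \<Rightarrow> nat) \<Rightarrow> real" where
  "grad i j f \<omega> = f (swap_coords i j \<omega>) - f \<omega>"

definition dirichlet ::
  "nat \<Rightarrow> (nat \<Rightarrow> nat) \<Rightarrow> ((nat \<Rightarrow> nat) \<Rightarrow> real) \<Rightarrow> ((nat \<Rightarrow> nat) \<Rightarrow> real) \<Rightarrow> real" where
  "dirichlet L \<kappa> f g =
     1 / (2 * real (msize L \<kappa>)) *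
     (\<Sum>j\<in>{1..msize L \<kappa>}. \<Sum>i\<in>{1..<j}. expect L \<kappa> (\<lambda>\<omega>. grad i j f \<omega> * grad i j g \<omega>))"

text \<open>The convention \<open>0 log 0 = 0\<close> is automatic, since the first factor vanishes.\<close>

definition entropy_ms :: "nat \<Rightarrow> (nat \<Rightarrow> nat) \<Rightarrow> ((nat \<Rightarrow> nat) \<Rightarrow> real) \<Rightarrow> real" where
  "entropy_ms L \<kappa> f =
     expect L \<kappa> (\<lambda>\<omega>. f \<omega> * ln (f \<omega>)) - expect L \<kappa> f * ln (expect L \<kappa> f)"

definition log_sobolev_ineq :: "nat \<Rightarrow> (nat \<Rightarrow> nat) \<Rightarrow> real \<Rightarrow> bool" where
  "log_sobolev_ineq L \<kappa> \<tau> \<longleftrightarrow>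
     (\<forall>f :: (nat \<Rightarrow> nat) \<Rightarrow> real. (\<forall>\<omega>\<in>multislice L \<kappa>. 0 \<le> f \<omega>) \<longrightarrow>
        entropy_ms L \<kappa> f \<le> \<tau> * dirichlet L \<kappa> (\<lambda>\<omega>. sqrt (f \<omega>)) (\<lambda>\<omega>. sqrt (f \<omega>)))"

text \<open>
  \<open>Least\<close> on \<^typ>\<open>real\<close> is specified only where a minimum exists, so any bound on \<open>\<tau>_LS\<close>
  has to establish that the minimum is attained.
\<close>

definition tau_LS :: "nat \<Rightarrow> (nat \<Rightarrow> nat) \<Rightarrow> real" where
  "tau_LS L \<kappa> = (LEAST \<tau>. 0 \<le> \<tau> \<and> log_sobolev_ineq L \<kappa> \<tau>)"

text \<open>
  \<^const>\<open>pmf_of_set\<close> is meaningful only on finite non-empty sets, and the values of functions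
  outside the multislice must not enter the Dirichlet form.
\<close>

lemma finite_multislice: "finite (multislice L \<kappa>)"
  by (rule finite_subset[of _ "{1..msize L \<kappa>} \<rightarrow>\<^sub>E {1..L}"])
     (auto simp: multislice_def intro!: finite_PiE)

lemma multislice_nonempty: "multislice L \<kappa> \<noteq> {}"
proof -
  let ?n = "msize L \<kappa>" and ?S = "SIGMA l:{1..L}. {..<\<kappa> l}"
  have "card {1..?n} = card ?S"
    by (simp add: msize_def)
  then obtain h where h: "bij_betw h {1..?n} ?S"
    by (metis finite_SigmaI finite_atLeastAtMost finite_lessThan finite_same_card_bij)
  define \<omega> where "\<omega> = restrict (\<lambda>i. fst (h i)) {1..?n}"
  have "\<omega> \<in> {1..?n} \<rightarrow>\<^sub>E {1..L}"
    using bij_betwE[OF h] by (force simp: \<omega>_def)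
  moreover have "card {i \<in> {1..?n}. \<omega> i = l} = \<kappa> l" if l: "l \<in> {1..L}" for l
  proof -
    have "h ` {i \<in> {1..?n}. \<omega> i = l} = {p \<in> h ` {1..?n}. fst p = l}"
      by (auto simp: \<omega>_def)
    also have "\<dots> = {l} \<times> {..<\<kappa> l}"
      using l bij_betw_imp_surj_on[OF h] by auto
    finally have img: "h ` {i \<in> {1..?n}. \<omega> i = l} = {l} \<times> {..<\<kappa> l}" .
    have "inj_on h {i \<in> {1..?n}. \<omega> i = l}"
      using bij_betw_imp_inj_on[OF h] by (rule inj_on_subset) auto
    from card_image[OF this] show ?thesis
      by (simp only: img card_cartesian_product) simp
  qed
  ultimately show ?thesis
    by (auto simp: multislice_def)
qed

lemma swap_coords_multislice:
  assumes "\<omega> \<in> multislice L \<kappa>" "i \<in> {1..msize L \<kappa>}" "j \<in> {1..msize L \<kappa>}"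
  shows "swap_coords i j \<omega> \<in> multislice L \<kappa>"
proof -
  let ?n = "msize L \<kappa>" and ?t = "Transposition.transpose i j"
  have eq: "swap_coords i j \<omega> k = \<omega> (?t k)" for k
    by (simp add: swap_coords_def)
  have t: "?t k \<in> {1..?n} \<longleftrightarrow> k \<in> {1..?n}" for k
    using assms(2,3) by (auto simp: Transposition.transpose_def)
  have "{k \<in> {1..?n}. swap_coords i j \<omega> k = l} = ?t ` {k \<in> {1..?n}. \<omega> k = l}" for l
  proof (intro set_eqI iffI)
    fix k assume "k \<in> {k \<in> {1..?n}. swap_coords i j \<omega> k = l}"
    then have "?t k \<in> {k \<in> {1..?n}. \<omega> k = l}"
      using t[of k] by (simp add: eq)
    then have "?t (?t k) \<in> ?t ` {k \<in> {1..?n}. \<omega> k = l}"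
      by (rule imageI)
    then show "k \<in> ?t ` {k \<in> {1..?n}. \<omega> k = l}"
      by simp
  next
    fix k assume "k \<in> ?t ` {k \<in> {1..?n}. \<omega> k = l}"
    then show "k \<in> {k \<in> {1..?n}. swap_coords i j \<omega> k = l}"
      using t by (auto simp: eq simp del: atLeastAtMost_iff)
  qed
  then have "card {k \<in> {1..?n}. swap_coords i j \<omega> k = l} = card {k \<in> {1..?n}. \<omega> k = l}" for l
    by (simp add: card_image)
  moreover have "swap_coords i j \<omega> \<in> {1..?n} \<rightarrow>\<^sub>E {1..L}"
    using assms by (force simp: multislice_def swap_coords_def Transposition.transpose_def PiE_iff extensional_def)
  ultimately show ?thesis
    using assms(1) by (simp add: multislice_def)
qed

lemma expect_eq_average:
  "expect L \<kappa> f = (\<Sum>\<omega>\<in>multislice L \<kappa>. f \<omega>) / real (card (multislice L \<kappa>))"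
  unfolding expect_def
  by (rule integral_pmf_of_set[OF multislice_nonempty finite_multislice])

end

theory Submission
  imports Defs
begin

text \<open>
  Write \<open>\<phi>(a, b) = (ln a - ln b) / (a - b)\<close>, the reciprocal of the logarithmic mean.

  For two colours of multiplicities \<open>a\<close> and \<open>b\<close> the log-Sobolev inequality holds with constant
  \<open>2 n \<phi>(a, b)\<close>. Revealing whether a coordinate \<open>i\<close> has the first colour, and averaging over \<open>i\<close>, reduces it
  to slices of size \<open>n - 1\<close> and to the sharp two-point inequality; the induction closes because
  \<open>(a - 1) \<phi>(a - 1, b) + (b - 1) \<phi>(a, b - 1) \<le> (a + b - 1) \<phi>(a, b)\<close>.

  For more colours, one proves by induction on their number a log-Sobolev inequality in which the transpositions
  exchanging the colours \<open>a\<close> and \<open>b\<close> carry, in place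
  of a constant, the weight
  \<open>4 + 2 ln (n / (2 \<kappa>\<^sub>a)) + 2 ln (n / (2 \<kappa>\<^sub>b))\<close>. Conditioning on the set of positions of a colour
  \<open>c\<close> leaves a multislice with one colour fewer, and the law of that set is a two-coloured slice;
  the resulting inequalities are averaged over \<open>c\<close> with probabilities proportional to \<open>n - \<kappa>\<^sub>c\<close>.

  The lower bound is obtained from the indicator of \<open>\<omega> 1\<close> being a colour of minimal multiplicity.
\<close>

subsection \<open>The reciprocal logarithmic mean\<close>

definition recip_logmean :: "real \<Rightarrow> real \<Rightarrow> real" where
  "recip_logmean a b = (if a = b then 1 / a else (ln a - ln b) / (a - b))"

lemma recip_logmean_commute: "recip_logmean a b = recip_logmean b a"
  by (simp add: recip_logmean_def) (metis minus_diff_eq minus_divide_divide)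

lemma recip_logmean_mult_diff:
  "(a - b) * recip_logmean a b = ln a - ln b"
  by (simp add: recip_logmean_def)

lemma recip_logmean_scale:
  assumes "c > 0" "a > 0" "b > 0"
  shows "c * recip_logmean (c * a) (c * b) = recip_logmean a b"
  using assms by (auto simp: recip_logmean_def ln_mult field_simps)

lemma recip_logmean_ge:
  assumes "a > 0" "a \<le> b"
  shows "recip_logmean a b \<ge> 1 / b"
proof (cases "a = b")
  case False
  have "ln (a / b) \<le> a / b - 1"
    using assms by (intro ln_le_minus_one) auto
  then have "(b - a) / b \<le> ln b - ln a"
    using assms by (simp add: ln_div diff_divide_distrib)
  then have "1 / b \<le> (ln b - ln a) / (b - a)"
    using assms False by (simp add: field_simps)
  then show ?thesis
    using False recip_logmean_commute[of a b] by (simp add: recip_logmean_def)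
qed (simp add: recip_logmean_def)

lemma recip_logmean_nonneg:
  assumes "a > 0" "b > 0"
  shows "recip_logmean a b \<ge> 0"
  using recip_logmean_ge[of a b] recip_logmean_ge[of b a] recip_logmean_commute[of a b] assms
  by (cases "a \<le> b") (auto intro: order_trans[rotated])

text \<open>The integrand has a logarithm as primitive. As an integral of reciprocals of linear
  functions, \<open>recip_logmean\<close> can be estimated by comparing rational functions of
  \<open>s\<close>.\<close>

lemma recip_logmean_has_integral:
  assumes "a > 0" "b > 0"
  shows "((\<lambda>s. 1 / (s * a + (1 - s) * b)) has_integral recip_logmean a b) {0..1}"
proof (cases "a = b")
  case True
  have "((\<lambda>s. 1 / a) has_integral 1 / a) {0..1::real}"
    using has_integral_const_real[of "1 / a" 0 1] by simp
  then show ?thesis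
    using True by (simp add: recip_logmean_def algebra_simps)
next
  case False
  have pos: "s * a + (1 - s) * b > 0" if "s \<in> {0..1}" for s
  proof (cases "s = 0")
    case False
    then have "s * a > 0" "(1 - s) * b \<ge> 0"
      using that assms by auto
    then show ?thesis by linarith
  qed (use assms in simp)
  have "((\<lambda>s. 1 / (s * a + (1 - s) * b)) has_integral
      ln (1 * a + (1 - 1) * b) / (a - b) - ln (0 * a + (1 - 0) * b) / (a - b)) {0..1}"
  proof (rule fundamental_theorem_of_calculus)
    fix s :: real assume s: "s \<in> {0..1}"
    show "((\<lambda>s. ln (s * a + (1 - s) * b) / (a - b)) has_vector_derivative
        1 / (s * a + (1 - s) * b)) (at s within {0..1})"
      unfolding has_real_derivative_iff_has_vector_derivative[symmetric]
      using pos[OF s] False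
      by (auto intro!: derivative_eq_intros simp: divide_simps)
  qed simp
  then show ?thesis
    using False by (simp add: recip_logmean_def diff_divide_distrib)
qed

text \<open>The inequality holds pointwise for the integrands of \<open>recip_logmean_has_integral\<close>.\<close>

lemma recip_logmean_recursion:
  assumes "a \<ge> 1" "b \<ge> 1"
  shows "(a - 1) * recip_logmean (a - 1) b + (b - 1) * recip_logmean a (b - 1)
    \<le> (a + b - 1) * recip_logmean a b"
proof (rule has_integral_le)
  \<comment> \<open>The alternative \<open>x = 0\<close> covers \<open>a = 1\<close> or
    \<open>b = 1\<close>: then \<open>recip_logmean\<close> is taken at an argument 0, where its
    value has no meaning, and the vanishing factor in front removes it.\<close>
  have scaled: "((\<lambda>s. x * (1 / (s * y + (1 - s) * z))) has_integral x * recip_logmean y z) {0..1}"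
    if "x = 0 \<or> y > 0 \<and> z > 0" for x y z
    using that recip_logmean_has_integral[of y z, THEN has_integral_mult_right, of x] by auto
  show "((\<lambda>s. (a - 1) * (1 / (s * (a - 1) + (1 - s) * b)) + (b - 1) * (1 / (s * a + (1 - s) * (b - 1))))
      has_integral (a - 1) * recip_logmean (a - 1) b + (b - 1) * recip_logmean a (b - 1)) {0..1}"
    using assms by (intro has_integral_add scaled) auto
  show "((\<lambda>s. (a + b - 1) * (1 / (s * a + (1 - s) * b)))
      has_integral (a + b - 1) * recip_logmean a b) {0..1}"
    using assms by (intro scaled) auto
  fix s :: real assume s: "s \<in> {0..1}"
  define X where "X = s * (a - 1)"
  define Y where "Y = (1 - s) * (b - 1)"
  define D1 where "D1 = X + Y + (1 - s)"
  define D2 where "D2 = X + Y + s"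
  have nonneg: "X \<ge> 0" "Y \<ge> 0"
    using s assms by (auto simp: X_def Y_def)
  have eqs: "s * (a - 1) + (1 - s) * b = D1" "s * a + (1 - s) * (b - 1) = D2"
      "s * a + (1 - s) * b = X + Y + 1"
    by (auto simp: D1_def D2_def X_def Y_def algebra_simps)
  \<comment> \<open>At the endpoints one of \<open>D1\<close>, \<open>D2\<close> can vanish, so
    denominators are cleared only for \<open>s\<close> strictly between 0 and 1.\<close>
  consider "s = 0" | "s = 1" | "0 < s" "s < 1"
    using s by force
  then show "(a - 1) * (1 / (s * (a - 1) + (1 - s) * b)) + (b - 1) * (1 / (s * a + (1 - s) * (b - 1)))
      \<le> (a + b - 1) * (1 / (s * a + (1 - s) * b))"
  proof cases
    case 1
    then show ?thesis
      using assms by (cases "b = 1") (auto simp: field_simps)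
  next
    case 2
    then show ?thesis
      using assms by (cases "a = 1") (auto simp: field_simps)
  next
    case 3
    then have D: "D1 > 0" "D2 > 0"
      using nonneg by (auto simp: D1_def D2_def)
    \<comment> \<open>After multiplication by \<open>D1\<close>, \<open>D2\<close> and
      \<open>X + Y + 1\<close> the comparison of integrands reduces to this inequality, whose
      deficit is a sum of nonnegative terms.\<close>
    have "X * D2 + Y * D1 \<le> D1 * D2"
    proof -
      have "0 \<le> s * Y + (1 - s) * X + s * (1 - s)"
        using nonneg 3 by simp
      also have "\<dots> = D1 * D2 - (X * D2 + Y * D1)"
        by (simp add: D1_def D2_def algebra_simps)
      finally show ?thesis by simp
    qed
    moreover have "(a - 1) * D2 * (D1 + s) + (b - 1) * D1 * (D2 + (1 - s))
        = (a + b - 2) * (D1 * D2) + (X * D2 + Y * D1)"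
      by (simp add: X_def Y_def algebra_simps)
    ultimately have "(a - 1) * D2 * (D1 + s) + (b - 1) * D1 * (D2 + (1 - s)) \<le> (a + b - 1) * (D1 * D2)"
      by (simp add: algebra_simps)
    moreover have "D1 + s = X + Y + 1" "D2 + (1 - s) = X + Y + 1"
      by (auto simp: D1_def D2_def)
    ultimately have "((a - 1) * D2 + (b - 1) * D1) * (X + Y + 1) \<le> (a + b - 1) * (D1 * D2)"
      by (simp add: algebra_simps)
    then have "((a - 1) * D2 + (b - 1) * D1) / (D1 * D2) \<le> (a + b - 1) / (X + Y + 1)"
      using D nonneg by (subst frac_le_eq) (auto simp: divide_simps)
    moreover have "((a - 1) * D2 + (b - 1) * D1) / (D1 * D2) = (a - 1) / D1 + (b - 1) / D2"
      using D by (simp add: field_simps)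
    ultimately show ?thesis
      unfolding eqs by simp
  qed
qed

text \<open>Trades a weight depending on both multiplicities for one that, with
  \<open>n = a + b\<close>, is a function of \<open>n / a\<close> alone and is increasing in
  \<open>n\<close>; the induction on the number of colours relies on this form. Equality holds at
  \<open>a = b\<close>. By homogeneity \<open>a = 1\<close> may be assumed.\<close>

lemma recip_logmean_upper:
  assumes "a > 0" "b > 0"
  shows "b * recip_logmean a b \<le> 1 + ln ((a + b) / (2 * a))"
proof -
  define y where "y = b / a"
  have y: "y > 0"
    using assms by (simp add: y_def)
  \<comment> \<open>For arguments 1 and \<open>y\<close>, \<open>m y\<close> is the deficit of the
    claim multiplied by \<open>y - 1\<close>. So \<open>m\<close> must have the sign of
    \<open>y - 1\<close>, which follows from \<open>m 1 = 0\<close> and monotonicity.\<close>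
  define m where "m = (\<lambda>y::real. (y - 1) * (ln (1 + y) - ln 2 + 1) - y * ln y)"
  have deriv: "(m has_real_derivative ln (1 + t) - ln 2 + (t - 1) / (1 + t) - ln t) (at t)" if "t > 0" for t
    unfolding m_def using that
    by (auto intro!: derivative_eq_intros)
  have deriv_nonneg: "ln (1 + t) - ln 2 + (t - 1) / (1 + t) - ln t \<ge> 0" if "t > 0" for t :: real
  proof -
    have "ln (2 * t / (1 + t)) \<le> 2 * t / (1 + t) - 1"
      using that by (intro ln_le_minus_one) auto
    also have "\<dots> = (t - 1) / (1 + t)"
      using that by (simp add: field_simps)
    finally show ?thesis
      using that by (simp add: ln_div ln_mult)
  qed
  have mono: "m s \<le> m t" if "0 < s" "s \<le> t" for s t
  proof (rule DERIV_nonneg_imp_nondecreasing[OF that(2)])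
    fix x assume "s \<le> x"
    then have "x > 0" using that by simp
    then show "\<exists>y. (m has_real_derivative y) (at x) \<and> y \<ge> 0"
      using deriv deriv_nonneg by blast
  qed
  have ln_half: "ln ((1 + y) / 2) = ln (1 + y) - ln 2"
    using y by (simp add: ln_div)
  have "m 1 = 0"
    by (simp add: m_def)
  have "y * recip_logmean 1 y \<le> 1 + ln ((1 + y) / 2)"
  proof (cases y "1::real" rule: linorder_cases)
    case less
    then have "m y \<le> 0"
      using mono[of y 1] y \<open>m 1 = 0\<close> by simp
    then show ?thesis
      using less by (simp add: m_def recip_logmean_def ln_half divide_simps) (simp add: algebra_simps)
  next
    case equal
    then show ?thesis by (simp add: recip_logmean_def)
  next
    case greater
    then have "m y \<ge> 0"
      using mono[of 1 y] \<open>m 1 = 0\<close> by simp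
    then show ?thesis
      using greater by (simp add: m_def recip_logmean_def ln_half divide_simps) (simp add: algebra_simps)
  qed
  moreover have "recip_logmean 1 y = a * recip_logmean a b"
    using recip_logmean_scale[of a 1 y] assms by (simp add: y_def)
  moreover have "y * (a * recip_logmean a b) = b * recip_logmean a b"
      "(1 + y) / 2 = (a + b) / (2 * a)"
    using assms by (auto simp: y_def field_simps)
  ultimately show ?thesis
    by simp
qed

subsection \<open>The two-point inequality\<close>

text \<open>Convexity of \<open>sinh\<close> on the half-line together with
  \<open>sinh 0 = 0\<close>. Equivalently \<open>sinh t / t\<close> is nondecreasing for positive
  \<open>t\<close>, which decides the sign of \<open>t - c * sinh t\<close> on either side of a
  positive zero.\<close>

lemma sinh_starshaped:
  fixes s t :: real
  assumes "0 \<le> s" "s \<le> t"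
  shows "t * sinh s \<le> s * sinh t"
proof (cases "t = 0")
  case False
  have "convex_on {0..} (sinh :: real \<Rightarrow> real)"
    by (rule f''_ge0_imp_convex[where f' = cosh and f'' = sinh])
       (auto intro!: derivative_eq_intros)
  from convex_onD[OF this, of "s / t" 0 t] have "sinh s \<le> s / t * sinh t"
    using assms False by simp
  then show ?thesis
    using assms False by (simp add: field_simps)
qed (use assms in simp)

text \<open>
  The deficit is invariant under \<open>u \<mapsto> 1 - u\<close>, and for \<open>u \<le> 1 / 2\<close> its derivative is
  \<open>2 (t - c sinh t)\<close> with \<open>t = ln ((1 - u) / u) / 2\<close>, where \<open>c\<close> is such that it
  vanishes at \<open>u = p\<close>.
\<close>

lemma two_point_log_sobolev_unit:
  assumes pq: "p > 0" "p \<le> q" "p + q = 1" and u: "0 \<le> u" "u \<le> 1"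
  shows "u * ln u + (1 - u) * ln (1 - u) - u * ln p - (1 - u) * ln q
    \<le> recip_logmean p q * (sqrt (q * u) - sqrt (p * (1 - u)))\<^sup>2"
proof -
  define w where "w = recip_logmean p q"
  define f where "f = (\<lambda>u. w * (q * u + p * (1 - u) - 2 * (sqrt p * sqrt q) * (sqrt u * sqrt (1 - u)))
    - (u * ln u + (1 - u) * ln (1 - u) - u * ln p - (1 - u) * ln q))"
  have "q > 0" using pq by simp
  have w_diff: "w * (q - p) = ln q - ln p"
    using recip_logmean_mult_diff[of q p] recip_logmean_commute[of p q] by (simp add: w_def mult.commute)
  \<comment> \<open>Reflecting \<open>u\<close> changes the deficit by a multiple of
    \<open>w * (q - p) - (ln q - ln p)\<close>, which vanishes because \<open>w\<close> is the
    reciprocal logarithmic mean.\<close>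
  have f_sym: "f (1 - u) = f u" for u
  proof -
    have "f u - f (1 - u) = (2 * u - 1) * (w * (q - p) - (ln q - ln p))"
      by (simp add: f_def algebra_simps)
    then show ?thesis by (simp add: w_diff)
  qed
  define c where "c = w * (sqrt p * sqrt q)"
  define T where "T = (\<lambda>u::real. (ln (1 - u) - ln u) / 2)"
  have sinh_T: "2 * sinh (T u) = sqrt (1 - u) / sqrt u - sqrt u / sqrt (1 - u)" if "0 < u" "u < 1" for u
  proof -
    have "T u = ln (sqrt (1 - u) / sqrt u)"
      using that by (simp add: T_def ln_div ln_sqrt diff_divide_distrib)
    then show ?thesis
      using that by (simp add: sinh_ln_real mult.commute)
  qed
  have T_mono: "T v \<le> T u" if "0 < u" "u \<le> v" "v < 1" for u v
    using that by (simp add: T_def diff_mono)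
  have T_nonneg: "T u \<ge> 0" if "0 < u" "u \<le> 1 / 2" for u
    using that by (simp add: T_def)
  have q_eq: "q = 1 - p" and p_half: "p \<le> 1 / 2" using pq by auto
  \<comment> \<open>At \<open>p\<close> the hyperbolic sine is
    \<open>(q - p) / (2 * sqrt p * sqrt q)\<close>, so the left side becomes
    \<open>w * (q - p) / 2\<close>, half the logarithm of \<open>q / p\<close>.\<close>
  have Tp: "c * sinh (T p) = T p"
  proof -
    have "2 * (c * sinh (T p)) = w * (sqrt p * sqrt q * (2 * sinh (T p)))"
      by (simp add: c_def)
    also have "2 * sinh (T p) = sqrt q / sqrt p - sqrt p / sqrt q"
      using sinh_T[of p] pq by (simp add: q_eq)
    also have "sqrt p * sqrt q * (sqrt q / sqrt p - sqrt p / sqrt q) = q - p"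
      using pq \<open>q > 0\<close> by (simp add: field_simps)
    also have "w * (q - p) = 2 * T p"
      by (simp add: w_diff T_def q_eq[symmetric])
    finally show ?thesis by simp
  qed
  have deriv: "(f has_real_derivative 2 * (T u - c * sinh (T u))) (at u)" if "0 < u" "u < 1" for u
  proof -
    have half: "sinh (T u) = sqrt (1 - u) / (2 * sqrt u) - sqrt u / (2 * sqrt (1 - u))"
      using sinh_T[OF that] by (simp add: field_simps)
    have roots: "((\<lambda>u. sqrt u * sqrt (1 - u)) has_real_derivative sinh (T u)) (at u)"
    proof -
      have "((\<lambda>u. sqrt (1 - u)) has_real_derivative inverse (sqrt (1 - u)) / 2 * (0 - 1)) (at u)"
        using that by (intro DERIV_chain2[OF DERIV_real_sqrt] DERIV_diff DERIV_const DERIV_ident) auto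
      from DERIV_mult[OF DERIV_real_sqrt[OF that(1)] this]
      have "((\<lambda>u. sqrt u * sqrt (1 - u)) has_real_derivative
          inverse (sqrt u) / 2 * sqrt (1 - u) + inverse (sqrt (1 - u)) / 2 * (0 - 1) * sqrt u) (at u)" .
      moreover have "inverse (sqrt u) / 2 * sqrt (1 - u) + inverse (sqrt (1 - u)) / 2 * (0 - 1) * sqrt u
          = sinh (T u)"
        unfolding half by (simp add: inverse_eq_divide)
      ultimately show ?thesis by simp
    qed
    have lin: "((\<lambda>u. q * u + p * (1 - u)) has_real_derivative q - p) (at u)"
      by (auto intro!: derivative_eq_intros)
    have ent: "((\<lambda>u. u * ln u + (1 - u) * ln (1 - u) - u * ln p - (1 - u) * ln q)
        has_real_derivative ln u - ln (1 - u) - ln p + ln q) (at u)"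
      using that by (auto intro!: derivative_eq_intros)
    have "(f has_real_derivative w * (q - p - 2 * (sqrt p * sqrt q) * sinh (T u))
        - (ln u - ln (1 - u) - ln p + ln q)) (at u)"
      unfolding f_def by (intro DERIV_diff DERIV_cmult lin roots ent)
    moreover have "w * (q - p - 2 * (sqrt p * sqrt q) * sinh (T u)) - (ln u - ln (1 - u) - ln p + ln q)
        = 2 * (T u - c * sinh (T u))"
      using w_diff by (simp add: c_def T_def algebra_simps)
    ultimately show ?thesis by simp
  qed
  have fp: "f p = 0"
  proof -
    have "sqrt p * sqrt q * (sqrt p * sqrt q) = p * q"
      using pq \<open>q > 0\<close> by (simp add: algebra_simps)
    then show ?thesis
      by (simp add: f_def q_eq[symmetric] mult.assoc)
  qed
  \<comment> \<open>\<open>T\<close> is decreasing, so \<open>T u \<ge> T p\<close>, and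
    \<open>sinh_starshaped\<close> compares with the zero at \<open>T p\<close>. For
    \<open>p = q\<close> that zero is 0 and the comparison says nothing; but then
    \<open>c = 1\<close>, and \<open>x \<le> sinh x\<close> is enough.\<close>
  have T_case1: "T u \<le> c * sinh (T u)" if "0 < u" "u \<le> p" for u
  proof (cases "p = q")
    case True
    then have "c = 1"
      using pq by (simp add: c_def w_def recip_logmean_def)
    then show ?thesis
      using real_le_x_sinh[OF T_nonneg[of u]] that p_half by (simp add: sinh_def exp_minus field_simps)
  next
    case False
    then have pos: "T p > 0"
      using pq by (simp add: T_def q_eq[symmetric])
    have "T u * sinh (T p) \<le> T p * sinh (T u)"
      using T_mono[of u p] that pos p_half by (intro sinh_starshaped) auto
    moreover have "c \<ge> 0"
      using pq \<open>q > 0\<close> recip_logmean_nonneg[of p q] by (simp add: c_def w_def)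
    ultimately have "c * (T u * sinh (T p)) \<le> c * (T p * sinh (T u))"
      by (rule mult_left_mono)
    then have "T u * (c * sinh (T p)) \<le> T p * (c * sinh (T u))"
      by (simp add: mult_ac)
    then have "T p * T u \<le> T p * (c * sinh (T u))"
      unfolding Tp by (simp add: mult_ac)
    then show ?thesis
      using pos by simp
  qed
  have T_case2: "c * sinh (T u) \<le> T u" if "p \<le> u" "u \<le> 1 / 2" for u
  proof (cases "p = q")
    case True
    then have "1 - u = u" using that pq by simp
    then have "T u = 0" unfolding T_def by (simp only:) simp
    then show ?thesis by simp
  next
    case False
    then have pos: "T p > 0"
      using pq by (simp add: T_def q_eq[symmetric])
    have "T p * sinh (T u) \<le> T u * sinh (T p)"
      using T_mono[of p u] that pq T_nonneg[of u] by (intro sinh_starshaped) auto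
    moreover have "c \<ge> 0"
      using pq \<open>q > 0\<close> recip_logmean_nonneg[of p q] by (simp add: c_def w_def)
    ultimately have "c * (T p * sinh (T u)) \<le> c * (T u * sinh (T p))"
      by (rule mult_left_mono)
    then have "T p * (c * sinh (T u)) \<le> T u * (c * sinh (T p))"
      by (simp add: mult_ac)
    then have "T p * (c * sinh (T u)) \<le> T p * T u"
      unfolding Tp by (simp add: mult_ac)
    then show ?thesis
      using pos by simp
  qed
  have f_left: "f u \<ge> 0" if u: "0 \<le> u" "u \<le> 1 / 2" for u
  proof -
    consider "u = 0" | "0 < u" "u \<le> p" | "p \<le> u"
      using u by linarith
    then show ?thesis
    proof cases
      case 1
      \<comment> \<open>The derivative formula is available only inside the interval, so the
        boundary value \<open>f 0 = p * w + ln q\<close> is estimated directly.\<close>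
      have "ln (1 / q) \<le> 1 / q - 1"
        using \<open>q > 0\<close> by (intro ln_le_minus_one) auto
      also have "\<dots> = p * (1 / q)"
        using pq \<open>q > 0\<close> by (simp add: field_simps)
      also have "\<dots> \<le> p * w"
        using pq recip_logmean_ge[of p q] unfolding w_def by (intro mult_left_mono) auto
      finally show ?thesis
        using 1 \<open>q > 0\<close> by (simp add: f_def ln_div mult.commute)
    next
      case 2
      have "f p \<le> f u"
      proof (rule DERIV_nonpos_imp_nonincreasing[OF 2(2)])
        fix x assume x: "u \<le> x" "x \<le> p"
        have "2 * (T x - c * sinh (T x)) \<le> 0"
          using T_case1[of x] x 2 by simp
        then show "\<exists>y. (f has_real_derivative y) (at x) \<and> y \<le> 0"
          using deriv[of x] x 2 p_half by (intro exI conjI) auto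
      qed
      then show ?thesis using fp by simp
    next
      case 3
      have "f p \<le> f u"
      proof (rule DERIV_nonneg_imp_nondecreasing[OF 3])
        fix x assume x: "p \<le> x" "x \<le> u"
        have "2 * (T x - c * sinh (T x)) \<ge> 0"
          using T_case2[of x] x u by simp
        then show "\<exists>y. (f has_real_derivative y) (at x) \<and> y \<ge> 0"
          using deriv[of x] x pq u by (intro exI conjI) auto
      qed
      then show ?thesis using fp by simp
    qed
  qed
  have "f u \<ge> 0"
    using f_left[of u] f_left[of "1 - u"] f_sym[of u] u by (cases "u \<le> 1 / 2") auto
  moreover have "(sqrt (q * u) - sqrt (p * (1 - u)))\<^sup>2
      = q * u + p * (1 - u) - 2 * (sqrt p * sqrt q) * (sqrt u * sqrt (1 - u))"
    unfolding real_sqrt_mult power2_diff power_mult_distrib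
    using pq u by (simp add: mult_ac)
  ultimately show ?thesis
    by (simp add: f_def w_def)
qed

text \<open>The inequality is homogeneous in \<open>(u, v)\<close> and in \<open>(a, b)\<close>
  separately, so both pairs can be normalised to sum 1. The unnormalised form takes
  \<open>u\<close>, \<open>v\<close> as total masses of a function on two blocks whose sizes are
  proportional to \<open>a\<close> and \<open>b\<close>.\<close>

lemma two_point_log_sobolev:
  assumes "a > 0" "b > 0" "u \<ge> 0" "v \<ge> 0"
  shows "u * ln (u / a) + v * ln (v / b) - (u + v) * ln ((u + v) / (a + b))
    \<le> recip_logmean a b * (sqrt (b * u) - sqrt (a * v))\<^sup>2"
  using assms
proof (induction a b arbitrary: u v rule: linorder_wlog)
  case (sym a b)
  from sym(1)[of v u] show ?case
    using sym by (simp add: recip_logmean_commute[of a b] power2_commute add.commute)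
next
  case (le a b)
  show ?case
  proof (cases "u + v = 0")
    case True
    then have "u = 0" "v = 0" using le by auto
    then show ?thesis by simp
  next
    case False
    define z where "z = u + v"
    have z: "z > 0" using False le by (simp add: z_def)
    define x where "x = u / z"
    have uv: "u = z * x" "v = z * (1 - x)" and x: "0 \<le> x" "x \<le> 1"
      using z le by (auto simp: x_def z_def field_simps)
    define n where "n = a + b"
    have n: "n > 0" using le by (simp add: n_def)
    define p where "p = a / n"
    define q where "q = b / n"
    have ab: "a = n * p" "b = n * q"
      using n by (auto simp: p_def q_def)
    have pq: "p > 0" "p \<le> q" "p + q = 1" "q > 0"
      using le n by (auto simp: p_def q_def n_def divide_right_mono add_divide_distrib[symmetric])
    have 1: "t * ln (z * t / (n * r)) = t * ln t - t * ln r + t * (ln z - ln n)" if "t \<ge> 0" "r > 0" for t r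
      using that z n by (cases "t = 0") (auto simp: ln_div ln_mult algebra_simps)
    have "0 \<le> 1 - x" using x by simp
    have "u * ln (u / a) + v * ln (v / b) - (u + v) * ln ((u + v) / (a + b))
        = z * (x * ln (z * x / (n * p)) + (1 - x) * ln (z * (1 - x) / (n * q)) - ln (z / n))"
      unfolding n_def[symmetric] z_def[symmetric] unfolding ab uv by (simp add: algebra_simps)
    also have "\<dots> = z * (x * ln x + (1 - x) * ln (1 - x) - x * ln p - (1 - x) * ln q)"
      unfolding 1[OF x(1) pq(1)] 1[OF \<open>0 \<le> 1 - x\<close> pq(4)]
      using z n by (simp add: ln_div algebra_simps)
    also have "\<dots> \<le> z * (recip_logmean p q * (sqrt (q * x) - sqrt (p * (1 - x)))\<^sup>2)"
      using two_point_log_sobolev_unit[of p q x] pq x z by (intro mult_left_mono) auto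
    also have "recip_logmean p q = n * recip_logmean a b"
      using recip_logmean_scale[of n p q] n pq by (simp add: ab)
    also have "z * (n * recip_logmean a b * (sqrt (q * x) - sqrt (p * (1 - x)))\<^sup>2)
        = recip_logmean a b * ((sqrt n * sqrt z) * (sqrt (q * x) - sqrt (p * (1 - x))))\<^sup>2"
      using n z by (simp add: power_mult_distrib)
    also have "(sqrt n * sqrt z) * (sqrt (q * x) - sqrt (p * (1 - x))) = sqrt (b * u) - sqrt (a * v)"
      unfolding ab uv real_sqrt_mult by (simp only: algebra_simps)
    finally show ?thesis .
  qed
qed

subsection \<open>Two colours\<close>

text \<open>The entropy with respect to the uniform distribution on \<open>S\<close>, multiplied by \<open>card S\<close>.\<close>

definition ent_sum :: "'a set \<Rightarrow> ('a \<Rightarrow> real) \<Rightarrow> real" where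
  "ent_sum S f = (\<Sum>x\<in>S. f x * ln (f x)) - sum f S * ln (sum f S / real (card S))"

lemma ent_sum_empty [simp]: "ent_sum {} f = 0"
  by (simp add: ent_sum_def)

lemma ent_sum_singleton [simp]: "ent_sum {x} f = 0"
  by (simp add: ent_sum_def)

lemma ent_sum_image:
  assumes "inj_on h S"
  shows "ent_sum (h ` S) f = ent_sum S (f \<circ> h)"
  using assms by (simp add: ent_sum_def sum.reindex card_image)

text \<open>Chain rule for two blocks. The bracket is the entropy between the blocks, written as the
  left side of \<open>two_point_log_sobolev\<close>.\<close>

lemma ent_sum_Un:
  assumes "finite S" "finite T" "S \<inter> T = {}"
  shows "ent_sum (S \<union> T) f = ent_sum S f + ent_sum T f +
    (sum f S * ln (sum f S / card S) + sum f T * ln (sum f T / card T)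
      - (sum f S + sum f T) * ln ((sum f S + sum f T) / (real (card S) + real (card T))))"
  using assms by (simp add: ent_sum_def sum.union_disjoint card_Un_disjoint)

text \<open>Chain rule along a map. Fibres of equal size push the uniform law forward to the uniform
  law on \<open>S\<close>, so the outer term is again an \<open>ent_sum\<close>, of the fibre
  averages.\<close>

lemma ent_sum_fibres:
  assumes "finite M" "finite S" "\<pi> ` M \<subseteq> S" "m > 0"
    and card_fibre: "\<And>y. y \<in> S \<Longrightarrow> card {x \<in> M. \<pi> x = y} = m"
  shows "ent_sum M f = (\<Sum>y\<in>S. ent_sum {x \<in> M. \<pi> x = y} f) +
    m * ent_sum S (\<lambda>y. (\<Sum>x | x \<in> M \<and> \<pi> x = y. f x) / m)"
proof -
  have group: "(\<Sum>y\<in>S. \<Sum>x | x \<in> M \<and> \<pi> x = y. g x) = sum g M" for g :: "_ \<Rightarrow> real"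
    using assms by (intro sum.group) auto
  have "card M = (\<Sum>y\<in>S. card {x \<in> M. \<pi> x = y})"
    using sum.group[of M S \<pi> "\<lambda>_. 1 :: nat"] assms by simp
  then have card_M: "card M = m * card S"
    using card_fibre by simp
  have "(\<Sum>y\<in>S. ent_sum {x \<in> M. \<pi> x = y} f) =
      (\<Sum>x\<in>M. f x * ln (f x)) - (\<Sum>y\<in>S. (\<Sum>x | x \<in> M \<and> \<pi> x = y. f x) *
        ln ((\<Sum>x | x \<in> M \<and> \<pi> x = y. f x) / m))"
    by (simp add: ent_sum_def sum_subtractf group card_fibre)
  moreover have "m * ent_sum S (\<lambda>y. (\<Sum>x | x \<in> M \<and> \<pi> x = y. f x) / m) =
      (\<Sum>y\<in>S. (\<Sum>x | x \<in> M \<and> \<pi> x = y. f x) * ln ((\<Sum>x | x \<in> M \<and> \<pi> x = y. f x) / m))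
      - sum f M * ln (sum f M / card M)"
    using \<open>m > 0\<close> unfolding ent_sum_def sum_divide_distrib[symmetric] group right_diff_distrib
      sum_distrib_left
    by (simp add: card_M)
  ultimately show ?thesis
    by (simp add: ent_sum_def)
qed

text \<open>The triangle inequality in Euclidean norm for the vectors of square roots. It bounds the
  energy of a summed function by the sum of the energies.\<close>

lemma sqrt_sum_diff_le:
  assumes "\<And>x. x \<in> S \<Longrightarrow> f x \<ge> 0" "\<And>x. x \<in> S \<Longrightarrow> g x \<ge> 0"
  shows "(sqrt (sum f S) - sqrt (sum g S))\<^sup>2 \<le> (\<Sum>x\<in>S. (sqrt (f x) - sqrt (g x))\<^sup>2)"
proof -
  have f: "sqrt (sum f S) = L2_set (\<lambda>x. sqrt (f x)) S" and g: "sqrt (sum g S) = L2_set (\<lambda>x. sqrt (g x)) S"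
    using assms by (simp_all add: L2_set_def)
  let ?d = "L2_set (\<lambda>x. sqrt (f x) - sqrt (g x)) S"
  have "L2_set (\<lambda>x. sqrt (f x)) S \<le> L2_set (\<lambda>x. sqrt (g x)) S + ?d"
    using L2_set_triangle_ineq[of "\<lambda>x. sqrt (g x)" "\<lambda>x. sqrt (f x) - sqrt (g x)" S] by simp
  moreover have "L2_set (\<lambda>x. sqrt (g x)) S \<le> L2_set (\<lambda>x. sqrt (f x)) S + ?d"
  proof -
    have "?d = L2_set (\<lambda>x. sqrt (g x) - sqrt (f x)) S"
      by (simp add: L2_set_def power2_commute)
    then show ?thesis
      using L2_set_triangle_ineq[of "\<lambda>x. sqrt (f x)" "\<lambda>x. sqrt (g x) - sqrt (f x)" S] by simp
  qed
  ultimately have "\<bar>sqrt (sum f S) - sqrt (sum g S)\<bar> \<le> ?d"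
    unfolding f g by simp
  then have "(sqrt (sum f S) - sqrt (sum g S))\<^sup>2 \<le> ?d\<^sup>2"
    by (metis abs_le_square_iff abs_of_nonneg L2_set_nonneg)
  also have "\<dots> = (\<Sum>x\<in>S. (sqrt (f x) - sqrt (g x))\<^sup>2)"
    by (simp add: L2_set_def sum_nonneg)
  finally show ?thesis .
qed

section \<open>Slices as families of \<open>k\<close>-element subsets\<close>

definition subsets :: "'a set \<Rightarrow> nat \<Rightarrow> 'a set set" where
  "subsets I k = {A. A \<subseteq> I \<and> card A = k}"

lemma finite_subsets: "finite I \<Longrightarrow> finite (subsets I k)"
  by (simp add: subsets_def)

lemma card_subsets: "finite I \<Longrightarrow> card (subsets I k) = card I choose k"
  by (simp add: subsets_def n_subsets)

text \<open>A set records the positions of the first of two colours. For \<open>i\<close> in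
  \<open>A\<close> and \<open>j\<close> outside, the modified set is the image of \<open>A\<close>
  under the transposition of \<open>i\<close> and \<open>j\<close>.\<close>

definition swap_energy :: "('a set \<Rightarrow> real) \<Rightarrow> 'a set \<Rightarrow> 'a \<Rightarrow> 'a \<Rightarrow> real" where
  "swap_energy f A i j = (sqrt (f (insert j (A - {i}))) - sqrt (f A))\<^sup>2"

lemma subsets_containing:
  assumes "finite I" "i \<in> I" "k > 0"
  shows "{A \<in> subsets I k. i \<in> A} = insert i ` subsets (I - {i}) (k - 1)"
proof (intro set_eqI iffI)
  fix A assume "A \<in> {A \<in> subsets I k. i \<in> A}"
  then have "A - {i} \<in> subsets (I - {i}) (k - 1)" "A = insert i (A - {i})"
    using assms finite_subset by (auto simp: subsets_def)
  then show "A \<in> insert i ` subsets (I - {i}) (k - 1)" by blast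
next
  fix A assume "A \<in> insert i ` subsets (I - {i}) (k - 1)"
  then obtain B where B: "B \<subseteq> I - {i}" "card B = k - 1" "A = insert i B"
    by (auto simp: subsets_def)
  moreover have "finite B" "i \<notin> B"
    using B assms finite_subset by auto
  ultimately show "A \<in> {A \<in> subsets I k. i \<in> A}"
    using assms by (auto simp: subsets_def)
qed

lemma subsets_avoiding: "{A \<in> subsets I k. i \<notin> A} = subsets (I - {i}) k"
  by (auto simp: subsets_def)

lemma inj_on_insert_subsets: "inj_on (insert i) (subsets (I - {i}) k)"
  by (force simp: inj_on_def subsets_def)

lemma swap_subsets:
  assumes "finite I" "A \<in> subsets I k" "i \<in> A" "j \<in> I - A"
  shows "insert j (A - {i}) \<in> subsets I k"
proof -
  have "finite A" "i \<in> A" "j \<notin> A - {i}" using assms finite_subset by (auto simp: subsets_def)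
  then have "card (insert j (A - {i})) = card A"
    by (metis card.insert_remove card_Suc_Diff1 card_insert_disjoint finite_Diff)
  then show ?thesis
    using assms by (auto simp: subsets_def)
qed

text \<open>
  Revealing whether \<open>i \<in> A\<close>: the swaps \<open>(A, j) \<mapsto> A - {i} \<union> {j}\<close> pair the two halves, so that
  the two-point inequality is controlled by the energy of the swaps moving \<open>i\<close>.
\<close>

lemma ent_sum_reveal_point:
  fixes f :: "'a set \<Rightarrow> real"
  assumes fin: "finite I" and i: "i \<in> I" and k: "0 < k" "k < card I"
    and f: "\<And>A. A \<in> subsets I k \<Longrightarrow> f A \<ge> 0"
  shows "ent_sum (subsets I k) f \<le>
    ent_sum {A \<in> subsets I k. i \<in> A} f + ent_sum {A \<in> subsets I k. i \<notin> A} f +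
    recip_logmean k (card I - k) *
      (\<Sum>A | A \<in> subsets I k \<and> i \<in> A. \<Sum>j\<in>I - A. swap_energy f A i j)"
proof -
  let ?S1 = "{A \<in> subsets I k. i \<in> A}" and ?S0 = "{A \<in> subsets I k. i \<notin> A}"
  define n where "n = card I"
  define N where "N = card (subsets I k)"
  have "N > 0" using k by (simp add: N_def card_subsets[OF fin])
  have finS: "finite (subsets I k)" by (rule finite_subsets[OF fin])
  have split: "subsets I k = ?S1 \<union> ?S0" "?S1 \<inter> ?S0 = {}"
    by auto
  define P where "P = (SIGMA A:?S1. I - A)"
  define Q where "Q = (SIGMA B:?S0. B)"
  \<comment> \<open>Keeping \<open>j\<close> in the pair makes the exchange invertible. Each
    \<open>A\<close> containing \<open>i\<close> occurs in \<open>n - k\<close> pairs of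
    \<open>P\<close>, and each \<open>B\<close> avoiding \<open>i\<close> in \<open>k\<close> pairs
    of \<open>Q\<close>.\<close>
  define \<theta> where "\<theta> = (\<lambda>(A, j). (insert j (A - {i}), j))"
  have bij: "bij_betw \<theta> P Q"
  proof (rule bij_betw_byWitness[where f' = "\<lambda>(B, j). (insert i (B - {j}), j)"])
    show "\<theta> ` P \<subseteq> Q"
      using swap_subsets[OF fin] i by (auto simp: P_def Q_def \<theta>_def)
    show "(\<lambda>(B, j). (insert i (B - {j}), j)) ` Q \<subseteq> P"
      using swap_subsets[OF fin, of _ k _ i] i by (auto simp: P_def Q_def subsets_def)
  qed (auto simp: P_def Q_def \<theta>_def)
  have card_compl: "card (I - A) = n - k" if "A \<in> subsets I k" for A
    using that fin by (auto simp: subsets_def n_def card_Diff_subset finite_subset)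
  have sum_P: "(\<Sum>(A, j)\<in>P. g A) = real (n - k) * sum g ?S1" for g :: "'a set \<Rightarrow> real"
  proof -
    have "(\<Sum>(A, j)\<in>P. g A) = (\<Sum>A\<in>?S1. \<Sum>j\<in>I - A. g A)"
      unfolding P_def using finS fin by (intro sum.Sigma[symmetric]) auto
    also have "\<dots> = (\<Sum>A\<in>?S1. real (n - k) * g A)"
      using card_compl by (intro sum.cong) auto
    finally show ?thesis by (simp add: sum_distrib_left)
  qed
  have sum_Q: "(\<Sum>(A, j)\<in>Q. g A) = real k * sum g ?S0" for g :: "'a set \<Rightarrow> real"
  proof -
    have "(\<Sum>(A, j)\<in>Q. g A) = (\<Sum>A\<in>?S0. \<Sum>j\<in>A. g A)"
      unfolding Q_def using finS fin by (intro sum.Sigma[symmetric]) (auto simp: subsets_def finite_subset)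
    also have "\<dots> = (\<Sum>A\<in>?S0. real k * g A)"
      by (intro sum.cong) (auto simp: subsets_def)
    finally show ?thesis by (simp add: sum_distrib_left)
  qed
  \<comment> \<open>Counting both sides of the bijection shows that the halves have sizes in the
    ratio \<open>k : n - k\<close>.\<close>
  have cards: "real (n - k) * card ?S1 = real k * card ?S0"
    using sum_P[of "\<lambda>_. 1"] sum_Q[of "\<lambda>_. 1"] bij_betw_same_card[OF bij] by (simp add: case_prod_unfold)
  have card_N: "real (card ?S1) + real (card ?S0) = N"
    using split finS by (metis N_def card_Un_disjoint finite_Un of_nat_add)
  have rnk: "real (n - k) = real n - real k" using k by (simp add: n_def)
  define c where "c = real N / real n"
  have "n > 0" using k by (simp add: n_def)
  then have "c > 0" using \<open>N > 0\<close> by (simp add: c_def)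
  have c1: "real (card ?S1) = c * k"
  proof -
    have "real n * card ?S1 - real k * N = ((real n - k) * card ?S1 - k * real (card ?S0))
        + k * (real (card ?S1) + real (card ?S0) - N)"
      by algebra
    then have "real n * card ?S1 = real k * N"
      using cards card_N by (simp add: rnk)
    then show ?thesis using \<open>n > 0\<close> by (simp add: c_def field_simps)
  qed
  have c0: "real (card ?S0) = c * (n - k)"
    using card_N c1 \<open>n > 0\<close> by (simp add: rnk c_def field_simps)
  let ?F1 = "sum f ?S1" and ?F0 = "sum f ?S0"
  have F: "?F1 \<ge> 0" "?F0 \<ge> 0" using f by (auto intro!: sum_nonneg)
  \<comment> \<open>A common factor \<open>c\<close> of the block sizes contributes
    \<open>ln c\<close> times the two masses minus their sum, that is 0, so \<open>k\<close> and
    \<open>n - k\<close> may replace the actual sizes.\<close>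
  have rescale: "x * ln (x / (c * y)) = x * ln (x / y) - x * ln c" if "x \<ge> 0" "y > 0" for x y
    using that \<open>c > 0\<close> by (cases "x = 0") (auto simp: ln_div ln_mult algebra_simps)
  have kpos: "real k > 0" "real (n - k) > 0" using k by (auto simp: n_def)
  have "?F1 * ln (?F1 / card ?S1) + ?F0 * ln (?F0 / card ?S0)
      - (?F1 + ?F0) * ln ((?F1 + ?F0) / (real (card ?S1) + real (card ?S0)))
    = ?F1 * ln (?F1 / k) + ?F0 * ln (?F0 / (n - k)) - (?F1 + ?F0) * ln ((?F1 + ?F0) / (real k + real (n - k)))"
    unfolding c1 c0 distrib_left[symmetric] rescale[OF F(1) kpos(1)] rescale[OF F(2) kpos(2)]
      rescale[OF add_nonneg_nonneg[OF F] add_pos_pos[OF kpos]]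
    by (simp add: distrib_right)
  also have "\<dots> \<le> recip_logmean k (n - k) * (sqrt (real (n - k) * ?F1) - sqrt (k * ?F0))\<^sup>2"
    using F kpos by (intro two_point_log_sobolev) auto
  also have "\<dots> \<le> recip_logmean k (n - k) * (\<Sum>A\<in>?S1. \<Sum>j\<in>I - A. swap_energy f A i j)"
  proof (rule mult_left_mono)
    \<comment> \<open>The multiplicities \<open>n - k\<close> and \<open>k\<close> turn both masses
      into sums over the same index set \<open>P\<close>, where they are compared term by
      term.\<close>
    have "(sqrt (real (n - k) * ?F1) - sqrt (k * ?F0))\<^sup>2
        = (sqrt (\<Sum>(A, j)\<in>P. f A) - sqrt (\<Sum>(A, j)\<in>P. f (insert j (A - {i}))))\<^sup>2"
    proof -
      have "(\<Sum>(A, j)\<in>P. f (insert j (A - {i}))) = (\<Sum>(A, j)\<in>Q. f A)"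
        using sum.reindex_bij_betw[OF bij, of "\<lambda>(A, j). f A"] by (simp add: \<theta>_def case_prod_unfold)
      then show ?thesis by (simp add: sum_P sum_Q)
    qed
    also have "\<dots> \<le> (\<Sum>(A, j)\<in>P. (sqrt (f A) - sqrt (f (insert j (A - {i}))))\<^sup>2)"
      unfolding case_prod_unfold
      using f swap_subsets[OF fin] i by (intro sqrt_sum_diff_le) (auto simp: P_def)
    also have "\<dots> = (\<Sum>A\<in>?S1. \<Sum>j\<in>I - A. swap_energy f A i j)"
      unfolding P_def swap_energy_def using finS fin
      by (subst sum.Sigma) (auto simp: power2_commute)
    finally show "(sqrt (real (n - k) * ?F1) - sqrt (k * ?F0))\<^sup>2
      \<le> (\<Sum>A\<in>?S1. \<Sum>j\<in>I - A. swap_energy f A i j)" .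
  qed (use kpos recip_logmean_nonneg in auto)
  finally show ?thesis
    using ent_sum_Un[of ?S1 ?S0 f] split finS by (simp add: n_def)
qed

text \<open>Each \<open>j\<close> is counted once for every other element \<open>i\<close> of
  \<open>A\<close>.\<close>

lemma sum_remove_each:
  fixes h :: "'a \<Rightarrow> real"
  assumes "finite A"
  shows "(\<Sum>i\<in>A. \<Sum>j\<in>A - {i}. h j) = (real (card A) - 1) * sum h A"
proof -
  have "(\<Sum>i\<in>A. \<Sum>j\<in>A - {i}. h j) = (\<Sum>i\<in>A. sum h A - h i)"
    using assms by (intro sum.cong) (auto simp: sum_diff1)
  then show ?thesis
    by (simp add: sum_subtractf algebra_simps)
qed

theorem subsets_log_sobolev:
  assumes "finite I" "k \<le> card I" "\<And>A. A \<in> subsets I k \<Longrightarrow> f A \<ge> 0"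
  shows "ent_sum (subsets I k) f \<le> recip_logmean k (card I - k) *
    (\<Sum>A\<in>subsets I k. \<Sum>i\<in>A. \<Sum>j\<in>I - A. swap_energy f A i j)"
  using assms
proof (induction "card I" arbitrary: I k f)
  case 0
  then have "subsets I k = {{}}"
    by (auto simp: subsets_def)
  then show ?case by simp
next
  case (Suc n)
  note fin = \<open>finite I\<close> and f = Suc.prems(3)
  have n: "card I = Suc n" using Suc.hyps by simp
  consider "k = 0" | "k = card I" | "0 < k" "k < card I"
    using Suc.prems by linarith
  then show ?case
  proof cases
    case 1
    \<comment> \<open>With a single set in the slice both sides vanish, whatever value
      \<open>recip_logmean\<close> takes at an argument 0.\<close>
    then have "subsets I k = {{}}"
      using fin by (auto simp: subsets_def finite_subset)
    then show ?thesis by simp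
  next
    case 2
    then have "subsets I k = {I}"
      using fin by (auto simp: subsets_def dest: card_subset_eq)
    then show ?thesis by simp
  next
    case 3
    let ?S = "subsets I k" and ?X = "swap_energy f"
    let ?m = "card I - k"
    have finS: "finite ?S" by (rule finite_subsets[OF fin])
    have finA: "finite A" if "A \<in> ?S" for A
      using that fin by (auto simp: subsets_def intro: finite_subset)
    have cards: "card A = k" "card (I - A) = ?m" "A \<subseteq> I" if "A \<in> ?S" for A
      using that fin finA[OF that] by (auto simp: subsets_def card_Diff_subset)
    define D where "D = (\<Sum>A\<in>?S. \<Sum>i\<in>A. \<Sum>j\<in>I - A. ?X A i j)"
    define D1 where "D1 = (\<lambda>i. \<Sum>A | A \<in> ?S \<and> i \<in> A. \<Sum>i'\<in>A - {i}. \<Sum>j\<in>I - A. ?X A i' j)"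
    define D0 where "D0 = (\<lambda>i. \<Sum>A | A \<in> ?S \<and> i \<notin> A. \<Sum>i'\<in>A. \<Sum>j\<in>I - A - {i}. ?X A i' j)"
    define D2 where "D2 = (\<lambda>i. \<Sum>A | A \<in> ?S \<and> i \<in> A. \<Sum>j\<in>I - A. ?X A i j)"
    \<comment> \<open>Both halves are slices over \<open>I - {i}\<close>: of size
      \<open>k - 1\<close> if \<open>i\<close> lies in \<open>A\<close>, and of size
      \<open>k\<close> with complement of size \<open>?m - 1\<close> otherwise. The induction
      hypothesis bounds them through the swaps fixing \<open>i\<close>.\<close>
    have reveal: "ent_sum ?S f \<le> recip_logmean (real k - 1) ?m * D1 i
        + recip_logmean k (real ?m - 1) * D0 i + recip_logmean k ?m * D2 i" if i: "i \<in> I" for i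
    proof -
      have "ent_sum {A \<in> ?S. i \<in> A} f \<le> recip_logmean (real k - 1) ?m * D1 i"
      proof -
        let ?T = "subsets (I - {i}) (k - 1)"
        have "ent_sum {A \<in> ?S. i \<in> A} f = ent_sum ?T (f \<circ> insert i)"
          unfolding subsets_containing[OF fin i 3(1)] by (rule ent_sum_image[OF inj_on_insert_subsets])
        also have "\<dots> \<le> recip_logmean (k - 1) (card (I - {i}) - (k - 1)) *
            (\<Sum>B\<in>?T. \<Sum>i'\<in>B. \<Sum>j\<in>I - {i} - B. swap_energy (f \<circ> insert i) B i' j)"
        proof (rule Suc.hyps(1))
          show "(f \<circ> insert i) B \<ge> 0" if "B \<in> ?T" for B
            using that f subsets_containing[OF fin i 3(1)] by auto
        qed (use n fin i 3 in auto)
        also have "(\<Sum>B\<in>?T. \<Sum>i'\<in>B. \<Sum>j\<in>I - {i} - B. swap_energy (f \<circ> insert i) B i' j) = D1 i"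
          unfolding D1_def subsets_containing[OF fin i 3(1)] sum.reindex[OF inj_on_insert_subsets] comp_def
        proof (intro sum.cong refl)
          fix B assume B: "B \<in> ?T"
          then have "i \<notin> B" by (auto simp: subsets_def)
          then show "B = insert i B - {i}" by auto
          fix i' assume "i' \<in> insert i B - {i}"
          then have "i' \<noteq> i" by auto
          show "I - {i} - B = I - insert i B" by auto
          fix j
          have "insert i (insert j (B - {i'})) = insert j (insert i B - {i'})"
            using \<open>i' \<noteq> i\<close> by auto
          then show "swap_energy (\<lambda>x. f (insert i x)) B i' j = ?X (insert i B) i' j"
            by (simp add: swap_energy_def)
        qed
        also have "card (I - {i}) - (k - 1) = ?m"
          using n fin i 3 by auto
        also have "real (k - 1) = real k - 1"
          using 3 by auto
        finally show ?thesis .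
      qed
      moreover have "ent_sum {A \<in> ?S. i \<notin> A} f \<le> recip_logmean k (real ?m - 1) * D0 i"
      proof -
        let ?T = "subsets (I - {i}) k"
        have "ent_sum ?T f \<le> recip_logmean k (card (I - {i}) - k) *
            (\<Sum>B\<in>?T. \<Sum>i'\<in>B. \<Sum>j\<in>I - {i} - B. swap_energy f B i' j)"
        proof (rule Suc.hyps(1))
          show "f A \<ge> 0" if "A \<in> ?T" for A
            using that f by (auto simp: subsets_def)
        qed (use n fin i 3 in auto)
        moreover have "real (card (I - {i}) - k) = real ?m - 1"
          using n fin i 3 by auto
        moreover have "I - {i} - B = I - B - {i}" for B by auto
        ultimately show ?thesis
          by (simp add: D0_def subsets_avoiding)
      qed
      ultimately show ?thesis
        using ent_sum_reveal_point[of I i k f, OF fin i 3 f] by (simp add: D2_def)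
    qed
    have swap: "(\<Sum>i\<in>I. \<Sum>A | A \<in> ?S \<and> R i A. g i A) = (\<Sum>A\<in>?S. \<Sum>i | i \<in> I \<and> R i A. g i A)"
      for g :: "'a \<Rightarrow> 'a set \<Rightarrow> real" and R
      by (rule sum.swap_restrict[OF fin finS])
    have in_A: "{i \<in> I. i \<in> A} = A" "{i \<in> I. i \<notin> A} = I - A" if "A \<in> ?S" for A
      using cards(3)[OF that] by auto
    \<comment> \<open>For a fixed swap of \<open>i'\<close> in \<open>A\<close> with
      \<open>j\<close> outside, the three totals count the revealed points: \<open>i'\<close>
      itself, the other \<open>k - 1\<close> points of \<open>A\<close>, and the
      \<open>?m - 1\<close> points outside \<open>A\<close> other than \<open>j\<close>.\<close>
    have "(\<Sum>i\<in>I. D2 i) = D"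
      unfolding D2_def D_def swap using in_A by (intro sum.cong) auto
    moreover have "(\<Sum>i\<in>I. D1 i) = (real k - 1) * D"
      unfolding D1_def D_def swap sum_distrib_left[of _ _ ?S]
      using in_A finA by (intro sum.cong) (auto simp: sum_remove_each cards)
    moreover have "(\<Sum>i\<in>I. D0 i) = (real ?m - 1) * D"
    proof -
      have "(\<Sum>i\<in>I - A. \<Sum>i'\<in>A. \<Sum>j\<in>I - A - {i}. ?X A i' j)
          = (real ?m - 1) * (\<Sum>i'\<in>A. \<Sum>j\<in>I - A. ?X A i' j)" if "A \<in> ?S" for A
        by (subst sum.swap) (simp add: sum_remove_each fin cards[OF that] sum_distrib_left)
      then show ?thesis
        unfolding D0_def D_def swap sum_distrib_left[of _ _ ?S]
        using in_A by (intro sum.cong) auto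
    qed
    moreover have "card I * ent_sum ?S f \<le> recip_logmean (real k - 1) ?m * (\<Sum>i\<in>I. D1 i)
        + recip_logmean k (real ?m - 1) * (\<Sum>i\<in>I. D0 i) + recip_logmean k ?m * (\<Sum>i\<in>I. D2 i)"
      using sum_mono[OF reveal, of I] by (simp add: sum.distrib sum_distrib_left)
    ultimately have "card I * ent_sum ?S f \<le> recip_logmean (real k - 1) ?m * ((real k - 1) * D)
        + recip_logmean k (real ?m - 1) * ((real ?m - 1) * D) + recip_logmean k ?m * D"
      by (simp only:)
    also have "\<dots> = ((real k - 1) * recip_logmean (real k - 1) ?m
          + (real ?m - 1) * recip_logmean k (real ?m - 1) + recip_logmean k ?m) * D"
      by (simp only: algebra_simps)
    also have "\<dots> \<le> (card I * recip_logmean k ?m) * D"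
    proof (rule mult_right_mono)
      have "(real k - 1) * recip_logmean (real k - 1) ?m + (real ?m - 1) * recip_logmean k (real ?m - 1)
          \<le> (real k + ?m - 1) * recip_logmean k ?m"
        using 3 by (intro recip_logmean_recursion) auto
      moreover have "real k + ?m = card I" using 3 by simp
      ultimately show "(real k - 1) * recip_logmean (real k - 1) ?m
          + (real ?m - 1) * recip_logmean k (real ?m - 1) + recip_logmean k ?m
          \<le> card I * recip_logmean k ?m"
        by (simp add: algebra_simps)
      show "D \<ge> 0"
        by (simp add: D_def swap_energy_def sum_nonneg)
    qed
    finally have "card I * ent_sum ?S f \<le> card I * (recip_logmean k ?m * D)"
      by (simp add: mult.assoc)
    then show ?thesis
      using n by (simp add: D_def)
  qed
qed

subsection \<open>Peeling off colours\<close>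

text \<open>
  Words are frozen to \<open>\<eta>\<close> outside \<open>I\<close>, so that prescribing the positions of one colour again
  gives a set of words.
\<close>

definition words :: "'i set \<Rightarrow> 'c set \<Rightarrow> ('c \<Rightarrow> nat) \<Rightarrow> ('i \<Rightarrow> 'c) \<Rightarrow> ('i \<Rightarrow> 'c) set" where
  "words I C \<kappa> \<eta> = {\<omega>. (\<forall>i. i \<notin> I \<longrightarrow> \<omega> i = \<eta> i) \<and> (\<forall>i\<in>I. \<omega> i \<in> C) \<and>
     (\<forall>c\<in>C. card {i \<in> I. \<omega> i = c} = \<kappa> c)}"

lemma finite_words:
  assumes "finite I" "finite C"
  shows "finite (words I C \<kappa> \<eta>)"
proof (rule finite_subset)
  show "words I C \<kappa> \<eta> \<subseteq> (\<lambda>g i. if i \<in> I then g i else \<eta> i) ` (I \<rightarrow>\<^sub>E C)"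
  proof
    fix \<omega> assume "\<omega> \<in> words I C \<kappa> \<eta>"
    then have "\<omega> = (\<lambda>i. if i \<in> I then restrict \<omega> I i else \<eta> i)" "restrict \<omega> I \<in> I \<rightarrow>\<^sub>E C"
      by (auto simp: words_def)
    then show "\<omega> \<in> (\<lambda>g i. if i \<in> I then g i else \<eta> i) ` (I \<rightarrow>\<^sub>E C)"
      by blast
  qed
qed (use assms in \<open>auto intro: finite_PiE\<close>)

lemma words_colour_class:
  "\<omega> \<in> words I C \<kappa> \<eta> \<Longrightarrow> c \<in> C \<Longrightarrow> {i \<in> I. \<omega> i = c} \<in> subsets I (\<kappa> c)"
  by (auto simp: words_def subsets_def)

lemma words_colour_fibre:
  assumes "finite I" "c \<in> C" "A \<in> subsets I (\<kappa> c)"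
  shows "{\<omega> \<in> words I C \<kappa> \<eta>. {i \<in> I. \<omega> i = c} = A}
    = words (I - A) (C - {c}) \<kappa> (\<lambda>i. if i \<in> A then c else \<eta> i)"
proof (intro set_eqI iffI)
  fix \<omega> assume "\<omega> \<in> {\<omega> \<in> words I C \<kappa> \<eta>. {i \<in> I. \<omega> i = c} = A}"
  then have \<omega>: "\<omega> \<in> words I C \<kappa> \<eta>" and A: "A = {i \<in> I. \<omega> i = c}" by auto
  have "{i \<in> I - A. \<omega> i = d} = {i \<in> I. \<omega> i = d}" if "d \<noteq> c" for d
    using that by (auto simp: A)
  then show "\<omega> \<in> words (I - A) (C - {c}) \<kappa> (\<lambda>i. if i \<in> A then c else \<eta> i)"
    using \<omega> by (auto simp: words_def A)
next
  fix \<omega> assume \<omega>: "\<omega> \<in> words (I - A) (C - {c}) \<kappa> (\<lambda>i. if i \<in> A then c else \<eta> i)"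
  have A: "A \<subseteq> I" "card A = \<kappa> c" using assms by (auto simp: subsets_def)
  have colour: "\<omega> i = c" if "i \<in> A" for i
    using \<omega> that by (auto simp: words_def)
  have col_class: "{i \<in> I. \<omega> i = c} = A"
    using \<omega> A colour by (auto simp: words_def)
  moreover have "{i \<in> I. \<omega> i = d} = {i \<in> I - A. \<omega> i = d}" if "d \<noteq> c" for d
    using that colour by auto
  then have "card {i \<in> I. \<omega> i = d} = \<kappa> d" if "d \<in> C" for d
    using \<omega> that col_class A by (cases "d = c") (auto simp: words_def)
  moreover have "\<omega> i \<in> C" if "i \<in> I" for i
    using \<omega> colour[of i] that \<open>c \<in> C\<close> by (cases "i \<in> A") (auto simp: words_def)
  moreover have "\<omega> i = \<eta> i" if "i \<notin> I" for i
    using \<omega> that A by (auto simp: words_def)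
  ultimately show "\<omega> \<in> {\<omega> \<in> words I C \<kappa> \<eta>. {i \<in> I. \<omega> i = c} = A}"
    by (auto simp: words_def)
qed

text \<open>Since \<open>N\<close> is chosen before \<open>I\<close> and \<open>\<eta>\<close>, all
  fibres over the position sets of a colour have the same size, as \<open>ent_sum_fibres\<close>
  requires. Removing one colour factors out a binomial coefficient.\<close>

lemma card_words_depends_on_card:
  assumes "finite C"
  shows "\<exists>N. \<forall>(I :: 'i set) \<eta>. finite I \<longrightarrow> card (words I C \<kappa> \<eta>) = N (card I)"
  using assms
proof (induction C)
  case empty
  have "words I {} \<kappa> \<eta> = (if I = {} then {\<eta>} else {})" for I :: "'i set" and \<eta> :: "'i \<Rightarrow> 'a"
    by (auto simp: words_def)
  then show ?case
    by (intro exI[of _ "\<lambda>n. if n = 0 then 1 else 0"]) auto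
next
  case (insert c C)
  then obtain N where N: "card (words I C \<kappa> \<eta>) = N (card I)" if "finite I" for I :: "'i set" and \<eta>
    by blast
  have "card (words I (insert c C) \<kappa> \<eta>) = (card I choose \<kappa> c) * N (card I - \<kappa> c)"
    if I: "finite I" for I :: "'i set" and \<eta>
  proof -
    let ?M = "words I (insert c C) \<kappa> \<eta>" and ?S = "subsets I (\<kappa> c)"
    have "card ?M = (\<Sum>A\<in>?S. card {\<omega> \<in> ?M. {i \<in> I. \<omega> i = c} = A})"
      using sum.group[of ?M ?S "\<lambda>\<omega>. {i \<in> I. \<omega> i = c}" "\<lambda>_. 1 :: nat"]
        finite_words[of I "insert c C"] finite_subsets[OF I] words_colour_class insert.hyps I
      by fastforce
    also have "\<dots> = (\<Sum>A\<in>?S. N (card I - \<kappa> c))"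
    proof (intro sum.cong refl)
      fix A assume A: "A \<in> ?S"
      then have "card (I - A) = card I - \<kappa> c"
        using I by (auto simp: subsets_def card_Diff_subset finite_subset)
      then show "card {\<omega> \<in> ?M. {i \<in> I. \<omega> i = c} = A} = N (card I - \<kappa> c)"
        using words_colour_fibre[where \<kappa> = \<kappa> and \<eta> = \<eta> and C = "insert c C", OF I _ A] N[of "I - A"] I insert.hyps by simp
    qed
    finally show ?thesis
      by (simp add: card_subsets[OF I])
  qed
  then show ?case
    by (intro exI[of _ "\<lambda>n. (n choose \<kappa> c) * N (n - \<kappa> c)"]) auto
qed

section \<open>Transpositions of words and their energy\<close>

abbreviation swap_word :: "'i \<Rightarrow> 'i \<Rightarrow> ('i \<Rightarrow> 'c) \<Rightarrow> 'i \<Rightarrow> 'c" where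
  "swap_word i j \<omega> \<equiv> \<omega> \<circ> Transposition.transpose i j"

lemma swap_word_class:
  assumes "i \<in> I" "j \<in> I"
  shows "{x \<in> I. swap_word i j \<omega> x = c} = Transposition.transpose i j ` {x \<in> I. \<omega> x = c}"
proof (intro set_eqI iffI)
  fix x assume "x \<in> {x \<in> I. swap_word i j \<omega> x = c}"
  then show "x \<in> Transposition.transpose i j ` {x \<in> I. \<omega> x = c}"
    using assms by (intro image_eqI[of _ _ "Transposition.transpose i j x"])
      (auto simp: Transposition.transpose_def)
qed (use assms in \<open>auto simp: Transposition.transpose_def\<close>)

lemma swap_word_in_words:
  assumes "\<omega> \<in> words I C \<kappa> \<eta>" "i \<in> I" "j \<in> I"
  shows "swap_word i j \<omega> \<in> words I C \<kappa> \<eta>"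
proof -
  have "card {x \<in> I. swap_word i j \<omega> x = c} = card {x \<in> I. \<omega> x = c}" for c
    unfolding swap_word_class[OF assms(2,3)] by (rule card_image) (rule inj_on_inverseI[of _ "Transposition.transpose i j"], simp)
  moreover have "swap_word i j \<omega> x = \<eta> x" if "x \<notin> I" for x
    using assms that by (auto simp: words_def Transposition.transpose_def)
  moreover have "swap_word i j \<omega> x \<in> C" if "x \<in> I" for x
    using assms that by (auto simp: words_def Transposition.transpose_def)
  ultimately show ?thesis
    using assms(1) unfolding words_def by simp
qed

definition word_energy :: "(('i \<Rightarrow> 'c) \<Rightarrow> real) \<Rightarrow> ('i \<Rightarrow> 'c) \<Rightarrow> 'i \<Rightarrow> 'i \<Rightarrow> real" where
  "word_energy f \<omega> i j = (sqrt (f (swap_word i j \<omega>)) - sqrt (f \<omega>))\<^sup>2"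

lemma word_energy_nonneg: "word_energy f \<omega> i j \<ge> 0"
  by (simp add: word_energy_def)

lemma word_energy_commute: "word_energy f \<omega> i j = word_energy f \<omega> j i"
  by (simp add: word_energy_def transpose_commute)

lemma word_energy_same_colour:
  assumes "\<omega> i = \<omega> j"
  shows "word_energy f \<omega> i j = 0"
proof -
  have "swap_word i j \<omega> = \<omega>"
    using assms by (auto simp: Transposition.transpose_def)
  then show ?thesis by (simp add: word_energy_def)
qed

text \<open>The sum runs over ordered pairs, so a constant \<open>K\<close> per transposition
  corresponds to the weight \<open>K / 2\<close>.\<close>

definition weighted_energy ::
  "'i set \<Rightarrow> ('i \<Rightarrow> 'c) set \<Rightarrow> ('c \<Rightarrow> 'c \<Rightarrow> real) \<Rightarrow> (('i \<Rightarrow> 'c) \<Rightarrow> real) \<Rightarrow> real" where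
  "weighted_energy I M w f = (\<Sum>\<omega>\<in>M. \<Sum>i\<in>I. \<Sum>j\<in>I. w (\<omega> i) (\<omega> j) * word_energy f \<omega> i j)"

text \<open>Conditioning on the positions of \<open>c\<close> splits the entropy. The fibres are
  handled by \<open>rest\<close>, whose weight \<open>\<psi>\<close> acts on swaps not involving
  \<open>c\<close>; the fibre averages live on a slice, where \<open>subsets_log_sobolev\<close>
  pays with swaps moving \<open>c\<close>. The inclusion in \<open>rest\<close> confines it to words
  on which \<open>f\<close> is known to be nonnegative.\<close>

lemma ent_sum_peel_colour:
  assumes fin: "finite I" "finite C" and c: "c \<in> C"
    and \<kappa>c: "0 < \<kappa> c" "\<kappa> c < card I"
    and f: "\<And>\<omega>. \<omega> \<in> words I C \<kappa> \<eta> \<Longrightarrow> f \<omega> \<ge> 0"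
    and rest: "\<And>A \<theta>. A \<in> subsets I (\<kappa> c) \<Longrightarrow>
        words (I - A) (C - {c}) \<kappa> \<theta> \<subseteq> words I C \<kappa> \<eta> \<Longrightarrow>
        ent_sum (words (I - A) (C - {c}) \<kappa> \<theta>) f
          \<le> weighted_energy (I - A) (words (I - A) (C - {c}) \<kappa> \<theta>) \<psi> f"
  shows "ent_sum (words I C \<kappa> \<eta>) f \<le> weighted_energy I (words I C \<kappa> \<eta>)
    (\<lambda>a b. if a = c \<or> b = c then recip_logmean (\<kappa> c) (card I - \<kappa> c) / 2 else \<psi> a b) f"
proof (cases "words I C \<kappa> \<eta> = {}")
  case True
  then show ?thesis by (simp add: weighted_energy_def)
next
  case False
  let ?M = "words I C \<kappa> \<eta>" and ?S = "subsets I (\<kappa> c)" and ?e = "word_energy f"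
  define \<phi> where "\<phi> = recip_logmean (\<kappa> c) (card I - \<kappa> c)"
  define P where "P = (\<lambda>\<omega>. {i \<in> I. \<omega> i = c})"
  define F where "F = (\<lambda>A. {\<omega> \<in> ?M. P \<omega> = A})"
  have F_words: "F A = words (I - A) (C - {c}) \<kappa> (\<lambda>i. if i \<in> A then c else \<eta> i)" if "A \<in> ?S" for A
    unfolding F_def P_def using words_colour_fibre[where \<kappa> = \<kappa>, OF fin(1) c that] .
  have finM: "finite ?M" and finS: "finite ?S"
    using fin by (auto intro: finite_words finite_subsets)
  have P_in: "P ` ?M \<subseteq> ?S"
    unfolding P_def using words_colour_class[OF _ c] by blast
  obtain N where N: "card (words J (C - {c}) \<kappa> \<theta>) = N (card J)" if "finite J" for J :: "'a set" and \<theta>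
    using card_words_depends_on_card[of "C - {c}" \<kappa>] fin by blast
  define m where "m = N (card I - \<kappa> c)"
  have card_F: "card (F A) = m" if "A \<in> ?S" for A
  proof -
    have "card (I - A) = card I - \<kappa> c"
      using that fin by (auto simp: subsets_def card_Diff_subset finite_subset)
    then show ?thesis
      using F_words[OF that] N[of "I - A"] fin by (simp add: m_def)
  qed
  obtain \<omega>0 where \<omega>0: "\<omega>0 \<in> ?M" using False by blast
  then have "F (P \<omega>0) \<noteq> {}" "finite (F (P \<omega>0))" "P \<omega>0 \<in> ?S"
    using P_in finM by (auto simp: F_def)
  then have "m > 0"
    using card_F[of "P \<omega>0"] card_gt_0_iff[of "F (P \<omega>0)"] by simp
  have group: "(\<Sum>A\<in>?S. \<Sum>\<omega>\<in>F A. h A \<omega>) = (\<Sum>\<omega>\<in>?M. h (P \<omega>) \<omega>)" for h :: "_ \<Rightarrow> _ \<Rightarrow> real"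
  proof -
    have "(\<Sum>A\<in>?S. \<Sum>\<omega>\<in>F A. h A \<omega>) = (\<Sum>A\<in>?S. \<Sum>\<omega>\<in>F A. h (P \<omega>) \<omega>)"
      by (intro sum.cong) (auto simp: F_def)
    also have "\<dots> = (\<Sum>\<omega>\<in>?M. h (P \<omega>) \<omega>)"
      unfolding F_def by (intro sum.group finM finS P_in)
    finally show ?thesis .
  qed
  define g where "g = (\<lambda>A. (\<Sum>\<omega>\<in>F A. f \<omega>) / m)"
  have f_F: "f \<omega> \<ge> 0" if "\<omega> \<in> F A" for A \<omega>
    using that f by (auto simp: F_def)
  have "ent_sum ?M f = (\<Sum>A\<in>?S. ent_sum (F A) f) + m * ent_sum ?S g"
    using ent_sum_fibres[OF finM finS P_in \<open>m > 0\<close>] card_F by (simp add: F_def g_def)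
  moreover have "(\<Sum>A\<in>?S. ent_sum (F A) f)
      \<le> (\<Sum>\<omega>\<in>?M. \<Sum>i\<in>I - P \<omega>. \<Sum>j\<in>I - P \<omega>. \<psi> (\<omega> i) (\<omega> j) * ?e \<omega> i j)"
  proof -
    have "(\<Sum>A\<in>?S. ent_sum (F A) f)
        \<le> (\<Sum>A\<in>?S. \<Sum>\<omega>\<in>F A. \<Sum>i\<in>I - A. \<Sum>j\<in>I - A. \<psi> (\<omega> i) (\<omega> j) * ?e \<omega> i j)"
    proof (rule sum_mono)
      fix A assume A: "A \<in> ?S"
      have "F A \<subseteq> ?M" by (auto simp: F_def)
      then show "ent_sum (F A) f \<le> (\<Sum>\<omega>\<in>F A. \<Sum>i\<in>I - A. \<Sum>j\<in>I - A. \<psi> (\<omega> i) (\<omega> j) * ?e \<omega> i j)"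
        using rest[OF A, of "\<lambda>i. if i \<in> A then c else \<eta> i"]
        unfolding F_words[OF A, symmetric] weighted_energy_def by simp
    qed
    then show ?thesis
      unfolding group .
  qed
  moreover have "m * ent_sum ?S g \<le> \<phi> * (\<Sum>\<omega>\<in>?M. \<Sum>i\<in>P \<omega>. \<Sum>j\<in>I - P \<omega>. ?e \<omega> i j)"
  proof -
    have "ent_sum ?S g \<le> \<phi> * (\<Sum>A\<in>?S. \<Sum>i\<in>A. \<Sum>j\<in>I - A. swap_energy g A i j)"
      unfolding \<phi>_def using fin(1) less_imp_le[OF \<kappa>c(2)] by (rule subsets_log_sobolev) (auto simp: g_def intro!: sum_nonneg divide_nonneg_nonneg f_F)
    then have "m * ent_sum ?S g \<le> m * (\<phi> * (\<Sum>A\<in>?S. \<Sum>i\<in>A. \<Sum>j\<in>I - A. swap_energy g A i j))"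
      by (rule mult_left_mono) simp
    also have "\<dots> = \<phi> * (\<Sum>A\<in>?S. \<Sum>i\<in>A. \<Sum>j\<in>I - A. m * swap_energy g A i j)"
      by (simp add: sum_distrib_left mult.left_commute)
    also have "\<dots> \<le> \<phi> * (\<Sum>A\<in>?S. \<Sum>i\<in>A. \<Sum>j\<in>I - A. \<Sum>\<omega>\<in>F A. ?e \<omega> i j)"
    proof (intro mult_left_mono sum_mono)
      fix A i j assume A: "A \<in> ?S" and i: "i \<in> A" and j: "j \<in> I - A"
      let ?A' = "insert j (A - {i})"
      have ij: "i \<in> I" "j \<in> I" using A i j by (auto simp: subsets_def)
      have P_swap: "P (swap_word i j \<omega>) = Transposition.transpose i j ` P \<omega>" for \<omega>
        unfolding P_def by (rule swap_word_class[OF ij])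
      have im1: "Transposition.transpose i j ` A = ?A'" and im2: "Transposition.transpose i j ` ?A' = A"
        using i j by (auto simp: Transposition.transpose_def image_iff split: if_splits)
      \<comment> \<open>The transposition maps the fibre over \<open>A\<close> bijectively onto the
        fibre over \<open>?A'\<close>, so the energy of the averages is at most the averaged
        energy.\<close>
      have "(\<Sum>\<omega>\<in>F ?A'. f \<omega>) = (\<Sum>\<omega>\<in>F A. f (swap_word i j \<omega>))"
        by (rule sum.reindex_bij_witness[of _ "swap_word i j" "swap_word i j"])
          (use im1 im2 P_swap swap_word_in_words[OF _ ij] in \<open>auto simp: F_def comp_assoc\<close>)
      then have "m * swap_energy g A i j
          = (sqrt (\<Sum>\<omega>\<in>F A. f (swap_word i j \<omega>)) - sqrt (\<Sum>\<omega>\<in>F A. f \<omega>))\<^sup>2"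
        using \<open>m > 0\<close>
        by (simp add: swap_energy_def g_def real_sqrt_divide diff_divide_distrib[symmetric] power_divide)
      also have "\<dots> \<le> (\<Sum>\<omega>\<in>F A. ?e \<omega> i j)"
        unfolding word_energy_def
        by (intro sqrt_sum_diff_le) (auto simp: F_def intro!: f swap_word_in_words ij)
      finally show "m * swap_energy g A i j \<le> (\<Sum>\<omega>\<in>F A. ?e \<omega> i j)" .
    next
      show "\<phi> \<ge> 0"
        unfolding \<phi>_def using \<kappa>c by (intro recip_logmean_nonneg) auto
    qed
    also have "(\<Sum>A\<in>?S. \<Sum>i\<in>A. \<Sum>j\<in>I - A. \<Sum>\<omega>\<in>F A. ?e \<omega> i j)
        = (\<Sum>A\<in>?S. \<Sum>\<omega>\<in>F A. \<Sum>i\<in>A. \<Sum>j\<in>I - A. ?e \<omega> i j)"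
    proof (rule sum.cong[OF refl])
      fix A
      have "(\<Sum>i\<in>A. \<Sum>j\<in>I - A. \<Sum>\<omega>\<in>F A. ?e \<omega> i j) = (\<Sum>i\<in>A. \<Sum>\<omega>\<in>F A. \<Sum>j\<in>I - A. ?e \<omega> i j)"
        by (subst sum.swap) simp
      also have "\<dots> = (\<Sum>\<omega>\<in>F A. \<Sum>i\<in>A. \<Sum>j\<in>I - A. ?e \<omega> i j)"
        by (rule sum.swap)
      finally show "(\<Sum>i\<in>A. \<Sum>j\<in>I - A. \<Sum>\<omega>\<in>F A. ?e \<omega> i j)
        = (\<Sum>\<omega>\<in>F A. \<Sum>i\<in>A. \<Sum>j\<in>I - A. ?e \<omega> i j)" .
    qed
    finally show ?thesis
      unfolding group .
  qed
  \<comment> \<open>Pairs inside \<open>P \<omega>\<close> have equal colours and no energy; a pair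
    with one point in \<open>P \<omega>\<close> occurs in both orders, which restores
    \<open>\<phi>\<close> from \<open>\<phi> / 2\<close>.\<close>
  moreover have "(\<Sum>i\<in>I. \<Sum>j\<in>I. (if \<omega> i = c \<or> \<omega> j = c then \<phi> / 2 else \<psi> (\<omega> i) (\<omega> j)) * ?e \<omega> i j)
      = (\<Sum>i\<in>I - P \<omega>. \<Sum>j\<in>I - P \<omega>. \<psi> (\<omega> i) (\<omega> j) * ?e \<omega> i j)
        + \<phi> * (\<Sum>i\<in>P \<omega>. \<Sum>j\<in>I - P \<omega>. ?e \<omega> i j)" for \<omega>
  proof -
    let ?h = "\<lambda>i j. (if \<omega> i = c \<or> \<omega> j = c then \<phi> / 2 else \<psi> (\<omega> i) (\<omega> j)) * ?e \<omega> i j"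
    let ?E = "\<Sum>i\<in>P \<omega>. \<Sum>j\<in>I - P \<omega>. ?e \<omega> i j"
    have split: "sum h I = sum h (I - P \<omega>) + sum h (P \<omega>)" for h :: "_ \<Rightarrow> real"
      using fin by (intro sum.subset_diff) (auto simp: P_def)
    have "(\<Sum>i\<in>P \<omega>. \<Sum>j\<in>P \<omega>. ?h i j) = 0"
      by (intro sum.neutral ballI) (auto simp: P_def word_energy_same_colour)
    moreover have "(\<Sum>i\<in>P \<omega>. \<Sum>j\<in>I - P \<omega>. ?h i j) = \<phi> / 2 * ?E"
      unfolding sum_distrib_left by (intro sum.cong) (auto simp: P_def)
    moreover have "(\<Sum>i\<in>I - P \<omega>. \<Sum>j\<in>P \<omega>. ?h i j) = \<phi> / 2 * ?E"
    proof -
      have "(\<Sum>i\<in>I - P \<omega>. \<Sum>j\<in>P \<omega>. ?h i j) = (\<Sum>j\<in>P \<omega>. \<Sum>i\<in>I - P \<omega>. ?h i j)"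
        by (rule sum.swap)
      also have "\<dots> = \<phi> / 2 * ?E"
        unfolding sum_distrib_left by (intro sum.cong) (auto simp: P_def word_energy_commute)
      finally show ?thesis .
    qed
    moreover have "(\<Sum>i\<in>I - P \<omega>. \<Sum>j\<in>I - P \<omega>. ?h i j)
        = (\<Sum>i\<in>I - P \<omega>. \<Sum>j\<in>I - P \<omega>. \<psi> (\<omega> i) (\<omega> j) * ?e \<omega> i j)"
      by (intro sum.cong) (auto simp: P_def)
    ultimately show ?thesis
      by (simp add: split sum.distrib)
  qed
  ultimately show ?thesis
    unfolding weighted_energy_def \<phi>_def[symmetric] by (simp add: sum.distrib sum_distrib_left)
qed

text \<open>\<open>x * \<Psi> x a b\<close> is increasing in \<open>x\<close> and is a sum of one
  half for \<open>a\<close> and one for \<open>b\<close>. Removing a third colour therefore gives at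
  most \<open>n * \<Psi> n a b\<close>, while removing \<open>a\<close> or \<open>b\<close> gives at
  most the corresponding half by \<open>recip_logmean_upper\<close>. Together this makes
  \<open>card C - 1\<close> copies.\<close>

lemma sum_peel_weights:
  fixes \<kappa> :: "'c \<Rightarrow> nat"
  defines "\<Psi> \<equiv> \<lambda>N a b. (2 + ln (N / (2 * real (\<kappa> a))) + ln (N / (2 * real (\<kappa> b)))) / (2 * N)"
  assumes fin: "finite C" and ab: "a \<in> C" "b \<in> C" "a \<noteq> b"
    and pos: "\<And>c. c \<in> C \<Longrightarrow> \<kappa> c > 0" and n: "n = (\<Sum>c\<in>C. \<kappa> c)"
  shows "(\<Sum>c\<in>C. real (n - \<kappa> c) * (if a = c \<or> b = c then recip_logmean (\<kappa> c) (n - \<kappa> c) / 2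
      else \<Psi> (real (n - \<kappa> c)) a b)) \<le> real n * (real (card C) - 1) * \<Psi> (real n) a b"
proof -
  define h where "h = (\<lambda>c. real (n - \<kappa> c) * (if a = c \<or> b = c then recip_logmean (\<kappa> c) (n - \<kappa> c) / 2
      else \<Psi> (real (n - \<kappa> c)) a b))"
  let ?l = "\<lambda>x. ln (real n / (2 * real (\<kappa> x)))"
  have less: "\<kappa> c < n" if "c \<in> C" for c
  proof -
    obtain d where d: "d \<in> C" "d \<noteq> c" using ab by metis
    have "\<kappa> c + \<kappa> d = (\<Sum>x\<in>{c, d}. \<kappa> x)" using d by simp
    also have "\<dots> \<le> n" unfolding n using that d fin by (intro sum_mono2) auto
    finally show ?thesis using pos[OF d(1)] by simp
  qed
  then have "n > 0" using ab by force
  have mult_\<Psi>: "x * \<Psi> x a b = (1 + ln (x / (2 * real (\<kappa> a)))) / 2 + (1 + ln (x / (2 * real (\<kappa> b)))) / 2"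
    if "x > 0" for x
  proof -
    have "x * ((2 + u + v) / (2 * x)) = (1 + u) / 2 + (1 + v) / 2" for u v
      using that by (simp add: field_simps)
    then show ?thesis by (simp add: \<Psi>_def)
  qed
  have n\<Psi>: "real n * \<Psi> (real n) a b = (1 + ?l a) / 2 + (1 + ?l b) / 2"
    using \<open>n > 0\<close> by (intro mult_\<Psi>) simp
  have ends: "h c \<le> (1 + ?l c) / 2" if "c \<in> {a, b}" for c
  proof -
    have "c \<in> C" using that ab by auto
    have "real (n - \<kappa> c) * recip_logmean (\<kappa> c) (n - \<kappa> c)
        \<le> 1 + ln ((real (\<kappa> c) + real (n - \<kappa> c)) / (2 * real (\<kappa> c)))"
      using pos[OF \<open>c \<in> C\<close>] less[OF \<open>c \<in> C\<close>] by (intro recip_logmean_upper) auto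
    moreover have "real (\<kappa> c) + real (n - \<kappa> c) = real n"
      using less[OF \<open>c \<in> C\<close>] by simp
    ultimately show ?thesis
      using that by (auto simp: h_def)
  qed
  have other: "h c \<le> real n * \<Psi> (real n) a b" if "c \<in> C - {a, b}" for c
  proof -
    have nc: "real (n - \<kappa> c) > 0" using less[of c] that by simp
    have "ln (real (n - \<kappa> c) / (2 * real (\<kappa> x))) \<le> ?l x" if "x \<in> C" for x
      using nc pos[OF that] by (intro ln_mono divide_right_mono) auto
    moreover have "h c = real (n - \<kappa> c) * \<Psi> (real (n - \<kappa> c)) a b"
      using that by (auto simp: h_def)
    ultimately show ?thesis
      unfolding n\<Psi> mult_\<Psi>[OF nc] using ab by (simp add: add_mono)
  qed
  have "sum h C = sum h (C - {a, b}) + (h a + h b)"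
    using sum.subset_diff[of "{a, b}" C h] fin ab by simp
  also have "\<dots> \<le> (\<Sum>c\<in>C - {a, b}. real n * \<Psi> (real n) a b) + real n * \<Psi> (real n) a b"
    unfolding n\<Psi> using other[unfolded n\<Psi>] ends[of a] ends[of b] by (intro add_mono sum_mono) auto
  also have "\<dots> = real n * (real (card C) - 1) * \<Psi> (real n) a b"
  proof -
    have "card {a, b} \<le> card C" using fin ab by (intro card_mono) auto
    then have card: "real (card (C - {a, b})) = real (card C) - 2"
      using fin ab by (simp add: card_Diff_subset)
    show ?thesis
      unfolding sum_constant card by (simp add: algebra_simps)
  qed
  finally show ?thesis by (simp add: h_def)
qed

text \<open>In the scale of \<open>dirichlet\<close>, which amounts to a factor
  \<open>4 * card I\<close>, the weight is 4 plus twice each logarithm. The induction generalises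
  over \<open>I\<close> and \<open>\<eta>\<close> because the fibres freeze further
  positions.\<close>

theorem words_log_sobolev:
  fixes \<kappa> :: "'c \<Rightarrow> nat"
  assumes "finite I" "finite C" "C \<noteq> {}" "\<And>c. c \<in> C \<Longrightarrow> \<kappa> c > 0" "card I = (\<Sum>c\<in>C. \<kappa> c)"
    and "\<And>\<omega>. \<omega> \<in> words I C \<kappa> \<eta> \<Longrightarrow> f \<omega> \<ge> 0"
  shows "ent_sum (words I C \<kappa> \<eta>) f \<le> weighted_energy I (words I C \<kappa> \<eta>)
    (\<lambda>a b. (2 + ln (card I / (2 * \<kappa> a)) + ln (card I / (2 * \<kappa> b))) / (2 * card I)) f"
  using assms
proof (induction "card C" arbitrary: C I \<eta>)
  case 0
  then show ?case by simp
next
  case (Suc L)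
  define \<Psi> where "\<Psi> = (\<lambda>N a b. (2 + ln (N / (2 * real (\<kappa> a))) + ln (N / (2 * real (\<kappa> b)))) / (2 * N))"
  let ?M = "words I C \<kappa> \<eta>"
  note fin = Suc.prems(1,2) and pos = Suc.prems(4) and card_I = Suc.prems(5) and f = Suc.prems(6)
  have M_colour: "\<omega> i \<in> C" if "\<omega> \<in> ?M" "i \<in> I" for \<omega> i
    using that by (auto simp: words_def)
  show ?case
  proof (cases "L = 0")
    case True
    then obtain c where C: "C = {c}"
      using Suc.hyps(2) by (metis One_nat_def card_1_singletonE)
    have "?M \<subseteq> {\<lambda>i. if i \<in> I then c else \<eta> i}"
      by (auto simp: words_def C)
    then have "ent_sum ?M f = 0"
      using subset_singletonD by fastforce
    moreover have "weighted_energy I ?M w f = 0" for w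
      unfolding weighted_energy_def
    proof (intro sum.neutral ballI)
      fix \<omega> i j assume "\<omega> \<in> ?M" "i \<in> I" "j \<in> I"
      then have "\<omega> i = \<omega> j" using M_colour C by (metis singletonD)
      then show "w (\<omega> i) (\<omega> j) * word_energy f \<omega> i j = 0"
        by (simp add: word_energy_same_colour)
    qed
    ultimately show ?thesis by simp
  next
    case False
    define n where "n = card I"
    have card_C: "card C = Suc L" using Suc.hyps(2) by simp
    have other: "C - {c} \<noteq> {}" for c
    proof -
      have "L \<le> card (C - {c})"
        using diff_card_le_card_Diff[of "{c}" C] card_C by simp
      then show ?thesis
        using False by (metis card.empty le_zero_eq)
    qed
    have n_split: "n = \<kappa> c + (\<Sum>d\<in>C - {c}. \<kappa> d)" if "c \<in> C" for c
      using sum.remove[OF fin(2) that, of \<kappa>] card_I by (simp add: n_def)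
    have less: "\<kappa> c < n" if "c \<in> C" for c
    proof -
      have "(\<Sum>d\<in>C - {c}. \<kappa> d) > 0"
        using other[of c] fin pos by (intro sum_pos) auto
      then show ?thesis using n_split[OF that] by simp
    qed
    define W where "W = (\<lambda>c a b. if a = c \<or> b = c then recip_logmean (\<kappa> c) (n - \<kappa> c) / 2
      else \<Psi> (real (n - \<kappa> c)) a b)"
    have peel: "ent_sum ?M f \<le> weighted_energy I ?M (W c) f" if c: "c \<in> C" for c
      unfolding W_def n_def
    proof (rule ent_sum_peel_colour[OF fin c])
      show "0 < \<kappa> c" "\<kappa> c < card I"
        using pos less c by (auto simp: n_def)
      fix A \<theta> assume A: "A \<in> subsets I (\<kappa> c)"
        and sub: "words (I - A) (C - {c}) \<kappa> \<theta> \<subseteq> ?M"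
      have card_diff: "card (I - A) = n - \<kappa> c"
        using A fin by (auto simp: subsets_def card_Diff_subset finite_subset n_def)
      have "ent_sum (words (I - A) (C - {c}) \<kappa> \<theta>) f \<le> weighted_energy (I - A) (words (I - A) (C - {c}) \<kappa> \<theta>)
        (\<lambda>a b. (2 + ln (card (I - A) / (2 * \<kappa> a)) + ln (card (I - A) / (2 * \<kappa> b))) / (2 * card (I - A))) f"
      proof (rule Suc.hyps(1))
        show "card (I - A) = (\<Sum>d\<in>C - {c}. \<kappa> d)"
          using card_diff n_split[OF c] by simp
      qed (use fin card_C c other pos f sub in auto)
      then show "ent_sum (words (I - A) (C - {c}) \<kappa> \<theta>) f
        \<le> weighted_energy (I - A) (words (I - A) (C - {c}) \<kappa> \<theta>) (\<Psi> (real (card I - \<kappa> c))) f"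
        unfolding card_diff \<Psi>_def n_def by simp
    qed (rule f)
    have "n > 0" using less Suc.prems(3) by fastforce
    \<comment> \<open>The total of the averaging weights: \<open>L\<close> is one less than the
      number of colours, and the multiplicities sum to \<open>n\<close>.\<close>
    define Z where "Z = real n * real L"
    have "Z > 0" using \<open>n > 0\<close> False by (simp add: Z_def)
    have Z_sum: "(\<Sum>c\<in>C. real (n - \<kappa> c)) = Z"
    proof -
      have "(\<Sum>c\<in>C. real (n - \<kappa> c)) = (\<Sum>c\<in>C. real n - real (\<kappa> c))"
        using less by (intro sum.cong) (auto simp: of_nat_diff less_imp_le)
      also have "\<dots> = real (card C) * n - real (\<Sum>c\<in>C. \<kappa> c)"
        by (simp add: sum_subtractf)
      also have "\<dots> = Z"
        using card_I card_C by (simp add: Z_def n_def algebra_simps)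
      finally show ?thesis .
    qed
    have "Z * ent_sum ?M f = (\<Sum>c\<in>C. real (n - \<kappa> c) * ent_sum ?M f)"
      by (simp add: Z_sum[symmetric] sum_distrib_right)
    also have "\<dots> \<le> (\<Sum>c\<in>C. real (n - \<kappa> c) * weighted_energy I ?M (W c) f)"
      by (intro sum_mono mult_left_mono peel) auto
    also have "\<dots> = weighted_energy I ?M (\<lambda>a b. \<Sum>c\<in>C. real (n - \<kappa> c) * W c a b) f"
    proof -
      have "(\<Sum>c\<in>C. real (n - \<kappa> c) * weighted_energy I ?M (W c) f)
          = (\<Sum>c\<in>C. \<Sum>\<omega>\<in>?M. \<Sum>i\<in>I. \<Sum>j\<in>I. real (n - \<kappa> c) * W c (\<omega> i) (\<omega> j) * word_energy f \<omega> i j)"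
        by (simp add: weighted_energy_def sum_distrib_left mult.assoc)
      also have "\<dots> = (\<Sum>\<omega>\<in>?M. \<Sum>i\<in>I. \<Sum>j\<in>I. \<Sum>c\<in>C. real (n - \<kappa> c) * W c (\<omega> i) (\<omega> j) * word_energy f \<omega> i j)"
        by (simp only: sum.swap[of _ _ C])
      finally show ?thesis
        by (simp add: weighted_energy_def sum_distrib_right)
    qed
    also have "\<dots> \<le> weighted_energy I ?M (\<lambda>a b. Z * \<Psi> (real n) a b) f"
      unfolding weighted_energy_def
    proof (intro sum_mono)
      fix \<omega> i j assume ij: "\<omega> \<in> ?M" "i \<in> I" "j \<in> I"
      show "(\<Sum>c\<in>C. real (n - \<kappa> c) * W c (\<omega> i) (\<omega> j)) * word_energy f \<omega> i j
          \<le> Z * \<Psi> (real n) (\<omega> i) (\<omega> j) * word_energy f \<omega> i j"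
      \<comment> \<open>\<open>sum_peel_weights\<close> concerns distinct colours; equal ones carry
        no energy.\<close>
      proof (cases "\<omega> i = \<omega> j")
        case True
        then show ?thesis by (simp add: word_energy_same_colour)
      next
        case False
        have "(\<Sum>c\<in>C. real (n - \<kappa> c) * W c (\<omega> i) (\<omega> j))
            \<le> real n * (real (card C) - 1) * \<Psi> (real n) (\<omega> i) (\<omega> j)"
          unfolding W_def \<Psi>_def using fin(2) M_colour ij False pos card_I
          by (intro sum_peel_weights) (auto simp: n_def)
        also have "real n * (real (card C) - 1) = Z"
          by (simp add: Z_def card_C)
        finally show ?thesis
          by (intro mult_right_mono word_energy_nonneg)
      qed
    qed
    also have "\<dots> = Z * weighted_energy I ?M (\<Psi> (real n)) f"
      by (simp add: weighted_energy_def sum_distrib_left mult.assoc)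
    finally have "ent_sum ?M f \<le> weighted_energy I ?M (\<Psi> (real n)) f"
      using \<open>Z > 0\<close> by simp
    then show ?thesis
      by (simp add: \<Psi>_def n_def)
  qed
qed

subsection \<open>The multislice\<close>

lemma multislice_eq_words:
  "multislice L \<kappa> = words {1..msize L \<kappa>} {1..L} \<kappa> (\<lambda>_. undefined)"
  unfolding multislice_def words_def PiE_iff extensional_def by blast

lemma sum_ordered_pairs:
  fixes h :: "nat \<Rightarrow> nat \<Rightarrow> real"
  assumes "\<And>i j. h i j = h j i" "\<And>i. h i i = 0"
  shows "(\<Sum>i\<in>{1..n}. \<Sum>j\<in>{1..n}. h i j) = 2 * (\<Sum>j\<in>{1..n}. \<Sum>i\<in>{1..<j}. h i j)"
proof (induction n)
  case (Suc n)
  have "(\<Sum>i\<in>{1..n}. h i (Suc n)) = (\<Sum>j\<in>{1..n}. h (Suc n) j)"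
    by (simp add: assms(1)[of _ "Suc n"])
  then show ?case
    using Suc by (simp add: sum.distrib assms(2) atLeastLessThanSuc_atLeastAtMost)
qed simp

lemma entropy_ms_eq_ent_sum:
  "entropy_ms L \<kappa> f = ent_sum (multislice L \<kappa>) f / card (multislice L \<kappa>)"
  by (simp add: entropy_ms_def ent_sum_def expect_eq_average diff_divide_distrib)

text \<open>The 4 combines the factor 2 in \<open>dirichlet\<close> with the double count of each
  transposition by ordered pairs.\<close>

lemma dirichlet_sqrt_eq:
  "dirichlet L \<kappa> (\<lambda>\<omega>. sqrt (f \<omega>)) (\<lambda>\<omega>. sqrt (f \<omega>)) =
    (\<Sum>\<omega>\<in>multislice L \<kappa>. \<Sum>i\<in>{1..msize L \<kappa>}. \<Sum>j\<in>{1..msize L \<kappa>}. word_energy f \<omega> i j)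
      / (4 * msize L \<kappa> * card (multislice L \<kappa>))"
proof -
  let ?M = "multislice L \<kappa>" and ?n = "msize L \<kappa>"
  have "(\<Sum>\<omega>\<in>?M. \<Sum>i\<in>{1..?n}. \<Sum>j\<in>{1..?n}. word_energy f \<omega> i j)
      = (\<Sum>\<omega>\<in>?M. 2 * (\<Sum>j\<in>{1..?n}. \<Sum>i\<in>{1..<j}. word_energy f \<omega> i j))"
    by (intro sum.cong sum_ordered_pairs refl word_energy_commute word_energy_same_colour)
  also have "\<dots> = 2 * (\<Sum>j\<in>{1..?n}. \<Sum>i\<in>{1..<j}. \<Sum>\<omega>\<in>?M. word_energy f \<omega> i j)"
    by (simp only: sum_distrib_left[symmetric] sum.swap[of _ _ ?M])
  also have "\<dots> = 2 * card ?M * (\<Sum>j\<in>{1..?n}. \<Sum>i\<in>{1..<j}. (\<Sum>\<omega>\<in>?M. word_energy f \<omega> i j) / card ?M)"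
    using finite_multislice[of L \<kappa>] multislice_nonempty[of L \<kappa>]
    by (simp add: sum_divide_distrib[symmetric])
  finally show ?thesis
    using finite_multislice[of L \<kappa>] multislice_nonempty[of L \<kappa>]
    by (simp add: dirichlet_def expect_eq_average grad_def swap_coords_def word_energy_def
        power2_eq_square)
qed

lemma kmin_attained:
  assumes "L \<ge> 1"
  obtains m where "m \<in> {1..L}" "kmin L \<kappa> = \<kappa> m"
proof -
  have "kmin L \<kappa> \<in> \<kappa> ` {1..L}"
    unfolding kmin_def using assms by (intro Min_in) auto
  then show ?thesis using that by blast
qed

lemma kmin_le: "l \<in> {1..L} \<Longrightarrow> kmin L \<kappa> \<le> \<kappa> l"
  by (simp add: kmin_def)

lemma two_kmin_le_msize:
  assumes "L \<ge> 2"
  shows "2 * kmin L \<kappa> \<le> msize L \<kappa>"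
proof -
  have "2 * kmin L \<kappa> \<le> L * kmin L \<kappa>"
    using assms by simp
  also have "\<dots> = (\<Sum>l=1..L. kmin L \<kappa>)" by simp
  also have "\<dots> \<le> msize L \<kappa>"
    unfolding msize_def by (intro sum_mono kmin_le)
  finally show ?thesis .
qed

text \<open>Replacing both multiplicities by the minimal one makes the weight of
  \<open>words_log_sobolev\<close>, in the scale of \<open>dirichlet\<close>, at most
  \<open>4 + 4 * (\<Lambda> - ln 2)\<close>.\<close>

lemma log_sobolev_ineq_multislice:
  assumes "L \<ge> 2" and pos: "\<And>l. l \<in> {1..L} \<Longrightarrow> \<kappa> l > 0"
  shows "log_sobolev_ineq L \<kappa> (4 / ln 2 * ln (msize L \<kappa> / kmin L \<kappa>))"
  unfolding log_sobolev_ineq_def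
proof (intro allI impI)
  fix f :: "(nat \<Rightarrow> nat) \<Rightarrow> real"
  assume f: "\<forall>\<omega>\<in>multislice L \<kappa>. 0 \<le> f \<omega>"
  let ?M = "multislice L \<kappa>" and ?n = "msize L \<kappa>" and ?I = "{1..msize L \<kappa>}"
  define \<Lambda> where "\<Lambda> = ln (msize L \<kappa> / kmin L \<kappa>)"
  have kmin: "kmin L \<kappa> > 0"
    using kmin_attained[of L \<kappa>] pos assms(1) by (metis One_nat_def Suc_1 Suc_leD)
  then have n: "?n > 0"
    using two_kmin_le_msize[OF assms(1), of \<kappa>] by simp
  have "2 \<le> real ?n / kmin L \<kappa>"
    using two_kmin_le_msize[OF assms(1), of \<kappa>] kmin by (simp add: le_divide_eq)
  then have \<Lambda>: "\<Lambda> \<ge> ln 2"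
    unfolding \<Lambda>_def by (intro ln_mono) auto
  have colour: "ln (?n / (2 * \<kappa> a)) \<le> \<Lambda> - ln 2" if a: "a \<in> {1..L}" for a
  proof -
    have "?n / (2 * \<kappa> a) \<le> ?n / (2 * kmin L \<kappa>)"
      using kmin_le[OF a, of \<kappa>] kmin pos[OF a] by (intro divide_left_mono) auto
    then have "ln (?n / (2 * \<kappa> a)) \<le> ln (?n / (2 * kmin L \<kappa>))"
      using n pos[OF a] by (intro ln_mono) auto
    then show ?thesis
      using n kmin by (simp add: \<Lambda>_def ln_div ln_mult)
  qed
  \<comment> \<open>The constant \<open>4 / ln 2\<close> arises here: the affine bound lies below
    the linear one for \<open>\<Lambda> \<ge> ln 2\<close>, with equality at
    \<open>\<Lambda> = ln 2\<close>, and two colours already force \<open>n\<close> to be at least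
    twice the minimum.\<close>
  have "4 * (1 - ln 2) * ln 2 \<le> 4 * (1 - ln 2) * \<Lambda>"
    using \<Lambda> ln_le_minus_one[of 2] by (intro mult_left_mono) auto
  then have numeric: "4 + 4 * (\<Lambda> - ln 2) \<le> 4 / ln 2 * \<Lambda>"
    by (simp add: field_simps)
  have "ent_sum ?M f \<le> weighted_energy ?I ?M
      (\<lambda>a b. (2 + ln (card ?I / (2 * \<kappa> a)) + ln (card ?I / (2 * \<kappa> b))) / (2 * card ?I)) f"
    unfolding multislice_eq_words
    using assms f by (intro words_log_sobolev) (auto simp: msize_def multislice_eq_words)
  also have "\<dots> \<le> weighted_energy ?I ?M (\<lambda>_ _. 4 / ln 2 * \<Lambda> / (4 * ?n)) f"
    unfolding weighted_energy_def
  proof (intro sum_mono mult_right_mono word_energy_nonneg)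
    fix \<omega> i j assume "\<omega> \<in> ?M" "i \<in> ?I" "j \<in> ?I"
    then have "\<omega> i \<in> {1..L}" "\<omega> j \<in> {1..L}"
      unfolding multislice_eq_words words_def by blast+
    then have "2 * (2 + ln (?n / (2 * \<kappa> (\<omega> i))) + ln (?n / (2 * \<kappa> (\<omega> j)))) \<le> 4 + 4 * (\<Lambda> - ln 2)"
      using colour[of "\<omega> i"] colour[of "\<omega> j"] by argo
    also note numeric
    finally have "2 * (2 + ln (?n / (2 * \<kappa> (\<omega> i))) + ln (?n / (2 * \<kappa> (\<omega> j)))) / (4 * ?n)
        \<le> 4 / ln 2 * \<Lambda> / (4 * ?n)"
      by (intro divide_right_mono) auto
    moreover have "2 * x / (4 * ?n) = x / (2 * card ?I)" for x :: real
      by simp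
    ultimately show "(2 + ln (card ?I / (2 * \<kappa> (\<omega> i))) + ln (card ?I / (2 * \<kappa> (\<omega> j)))) / (2 * card ?I)
        \<le> 4 / ln 2 * \<Lambda> / (4 * ?n)"
      by (simp only: card_atLeastAtMost diff_Suc_1)
  qed
  finally have "ent_sum ?M f / card ?M \<le> weighted_energy ?I ?M (\<lambda>_ _. 4 / ln 2 * \<Lambda> / (4 * ?n)) f / card ?M"
    by (intro divide_right_mono) auto
  also have "\<dots> = 4 / ln 2 * \<Lambda> * dirichlet L \<kappa> (\<lambda>\<omega>. sqrt (f \<omega>)) (\<lambda>\<omega>. sqrt (f \<omega>))"
    unfolding weighted_energy_def dirichlet_sqrt_eq sum_distrib_left[symmetric] by simp
  finally show "entropy_ms L \<kappa> f \<le> 4 / ln 2 * ln (msize L \<kappa> / kmin L \<kappa>) *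
      dirichlet L \<kappa> (\<lambda>\<omega>. sqrt (f \<omega>)) (\<lambda>\<omega>. sqrt (f \<omega>))"
    by (simp add: entropy_ms_eq_ent_sum \<Lambda>_def)
qed

text \<open>With \<open>p = k / n\<close>, the indicator has entropy \<open>- p * ln p\<close> and
  Dirichlet form \<open>p * (1 - p)\<close>, so \<open>\<tau> * (1 - p)\<close> is at least
  \<open>ln (n / k)\<close>.\<close>

lemma log_sobolev_ineq_lower:
  assumes "L \<ge> 2" and pos: "\<And>l. l \<in> {1..L} \<Longrightarrow> \<kappa> l > 0"
    and \<tau>: "\<tau> \<ge> 0" "log_sobolev_ineq L \<kappa> \<tau>"
  shows "ln (msize L \<kappa> / kmin L \<kappa>) \<le> \<tau>"
proof -
  let ?M = "multislice L \<kappa>" and ?I = "{1..msize L \<kappa>}"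
  define n where "n = msize L \<kappa>"
  define N where "N = card ?M"
  obtain m where m: "m \<in> {1..L}" "kmin L \<kappa> = \<kappa> m"
    using kmin_attained[of L \<kappa>] assms(1) by auto
  define k where "k = \<kappa> m"
  have k: "k > 0" "2 * k \<le> n"
    using pos[OF m(1)] two_kmin_le_msize[OF assms(1), of \<kappa>] m by (auto simp: k_def n_def)
  then have n: "n > 0" "1 \<in> ?I" by (auto simp: n_def)
  have finM: "finite ?M" by (rule finite_multislice)
  have "N > 0"
    using multislice_nonempty finM by (simp add: N_def card_gt_0_iff)
  have count: "card {i \<in> ?I. \<omega> i = m} = k" if "\<omega> \<in> ?M" for \<omega>
    using that m by (auto simp: multislice_def k_def)
  define N1 where "N1 = card {\<omega> \<in> ?M. \<omega> 1 = m}"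
  \<comment> \<open>Exchanging coordinates 1 and \<open>i\<close> shows that every coordinate has
    colour \<open>m\<close> equally often; double counting then gives the probability
    \<open>k / n\<close>.\<close>
  have "card {\<omega> \<in> ?M. \<omega> i = m} = N1" if i: "i \<in> ?I" for i
    unfolding N1_def
    by (rule bij_betw_same_card[of "swap_word 1 i"], rule bij_betw_byWitness[where f' = "swap_word 1 i"])
      (use swap_word_in_words[OF _ n(2) i] in
        \<open>auto simp: multislice_eq_words comp_assoc\<close>)
  then have "n * N1 = (\<Sum>i\<in>?I. card {\<omega> \<in> ?M. \<omega> i = m})"
    by (simp add: n_def)
  also have "\<dots> = (\<Sum>\<omega>\<in>?M. card {i \<in> ?I. \<omega> i = m})"
    using sum.swap_restrict[of ?I ?M "\<lambda>_ _. 1 :: nat" "\<lambda>i \<omega>. \<omega> i = m"] finM by simp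
  also have "\<dots> = N * k"
    using count by (simp add: N_def)
  finally have N1: "real n * N1 = real N * k"
    by (metis of_nat_mult)
  then have N1_ratio: "real N1 / N = real k / n"
    using n \<open>N > 0\<close> by (simp add: field_simps)
  then have "N1 > 0"
    using k n \<open>N > 0\<close> by (metis divide_eq_0_iff gr0I neq0_conv of_nat_0 of_nat_eq_0_iff)
  define f where "f = (\<lambda>\<omega> :: nat \<Rightarrow> nat. if \<omega> 1 = m then 1 else 0 :: real)"
  have sum_f: "sum f ?M = N1"
    using finM by (simp add: f_def N1_def sum.If_cases Int_def)
  have "ent_sum ?M f = - real N1 * ln (real N1 / N)"
  proof -
    have "(\<Sum>\<omega>\<in>?M. f \<omega> * ln (f \<omega>)) = 0"
      by (intro sum.neutral) (simp add: f_def)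
    then show ?thesis by (simp add: ent_sum_def sum_f N_def)
  qed
  also have "\<dots> = N1 * ln (n / k)"
    using k n by (simp add: N1_ratio ln_div algebra_simps)
  finally have ent: "entropy_ms L \<kappa> f = real N1 / N * ln (n / k)"
    by (simp add: entropy_ms_eq_ent_sum N_def)
  \<comment> \<open>\<open>f\<close> depends on coordinate 1 alone, so only swaps of 1 with a
    \<open>j\<close> such that exactly one of the two has colour \<open>m\<close> contribute, each
    with energy 1.\<close>
  have energy: "(\<Sum>i\<in>?I. \<Sum>j\<in>?I. word_energy f \<omega> i j) = 2 * (if \<omega> 1 = m then real (n - k) else real k)"
    if \<omega>: "\<omega> \<in> ?M" for \<omega>
  proof -
    have "(\<Sum>i\<in>?I. \<Sum>j\<in>?I. word_energy f \<omega> i j) = 2 * (\<Sum>j\<in>?I. \<Sum>i\<in>{1..<j}. word_energy f \<omega> i j)"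
      by (intro sum_ordered_pairs word_energy_commute word_energy_same_colour refl)
    also have "(\<Sum>j\<in>?I. \<Sum>i\<in>{1..<j}. word_energy f \<omega> i j) = (\<Sum>j\<in>?I. word_energy f \<omega> 1 j)"
    proof (intro sum.cong refl)
      fix j assume "j \<in> ?I"
      show "(\<Sum>i\<in>{1..<j}. word_energy f \<omega> i j) = word_energy f \<omega> 1 j"
      proof (cases "j = 1")
        case True
        then show ?thesis by (simp add: word_energy_same_colour)
      next
        case False
        then have "1 \<in> {1..<j}" using \<open>j \<in> ?I\<close> by auto
        moreover have "word_energy f \<omega> i j = 0" if "i \<in> {1..<j} - {1}" for i
          using that by (auto simp: word_energy_def f_def Transposition.transpose_def)
        ultimately show ?thesis
          by (subst sum.remove[of _ 1]) auto
      qed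
    qed
    also have "\<dots> = (\<Sum>j\<in>?I. if (\<omega> j = m) \<noteq> (\<omega> 1 = m) then 1 else 0)"
      by (intro sum.cong) (auto simp: word_energy_def f_def)
    also have "\<dots> = real (card {j \<in> ?I. (\<omega> j = m) \<noteq> (\<omega> 1 = m)})"
      by (simp add: sum.If_cases Int_def)
    also have "\<dots> = (if \<omega> 1 = m then real (n - k) else real k)"
    proof -
      have "card (?I - {j \<in> ?I. \<omega> j = m}) = card ?I - card {j \<in> ?I. \<omega> j = m}"
        by (rule card_Diff_subset) auto
      also have "?I - {j \<in> ?I. \<omega> j = m} = {j \<in> ?I. \<omega> j \<noteq> m}" by auto
      finally have "card {j \<in> ?I. \<omega> j \<noteq> m} = n - k"
        unfolding count[OF \<omega>] by (simp add: n_def)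
      then show ?thesis using count[OF \<omega>] by simp
    qed
    finally show ?thesis .
  qed
  have "(\<Sum>\<omega>\<in>?M. \<Sum>i\<in>?I. \<Sum>j\<in>?I. word_energy f \<omega> i j)
      = (\<Sum>\<omega>\<in>?M. 2 * (if \<omega> 1 = m then real (n - k) else real k))"
    by (intro sum.cong energy refl)
  also have "\<dots> = (\<Sum>\<omega>\<in>?M. 2 * k + 2 * (real n - 2 * real k) * f \<omega>)"
    using k by (intro sum.cong) (auto simp: f_def of_nat_diff)
  also have "\<dots> = 2 * real k * N + 2 * (real n - 2 * real k) * N1"
    by (simp add: sum.distrib sum_distrib_left[symmetric] sum_f N_def)
  also have "\<dots> = 4 * N1 * (real n - k)"
    using N1 by (simp add: algebra_simps)
  finally have "dirichlet L \<kappa> (\<lambda>\<omega>. sqrt (f \<omega>)) (\<lambda>\<omega>. sqrt (f \<omega>)) = real N1 / N * ((real n - k) / n)"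
    by (simp add: dirichlet_sqrt_eq n_def[symmetric] N_def[symmetric])
  moreover have "entropy_ms L \<kappa> f \<le> \<tau> * dirichlet L \<kappa> (\<lambda>\<omega>. sqrt (f \<omega>)) (\<lambda>\<omega>. sqrt (f \<omega>))"
    using \<tau>(2) unfolding log_sobolev_ineq_def by (auto simp: f_def)
  ultimately have "real N1 / N * ln (n / k) \<le> real N1 / N * (\<tau> * ((real n - k) / n))"
    by (simp add: ent mult.left_commute)
  then have "ln (n / k) \<le> \<tau> * ((real n - k) / n)"
    by (rule mult_left_le_imp_le) (use \<open>N > 0\<close> \<open>N1 > 0\<close> in simp)
  also have "\<dots> \<le> \<tau> * 1"
    using \<tau>(1) n k by (intro mult_left_mono) auto
  finally show ?thesis
    by (simp add: m(2) n_def k_def)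
qed

section \<open>Attainment of the optimal constant\<close>

lemma dirichlet_self_nonneg: "dirichlet L \<kappa> g g \<ge> 0"
  unfolding dirichlet_def expect_eq_average
  by (intro zero_le_square mult_nonneg_nonneg sum_nonneg divide_nonneg_nonneg) auto

text \<open>Each \<open>f\<close> imposes on \<open>\<tau>\<close> either a closed lower bound or,
  if its Dirichlet form vanishes, a condition independent of \<open>\<tau>\<close>. The admissible
  set is therefore closed under infimum, and \<open>LEAST\<close> picks out a genuine
  minimum.\<close>

lemma tau_LS_eq_Inf:
  assumes "\<tau>0 \<ge> 0" "log_sobolev_ineq L \<kappa> \<tau>0"
  shows "tau_LS L \<kappa> = Inf {\<tau>. 0 \<le> \<tau> \<and> log_sobolev_ineq L \<kappa> \<tau>}"
proof -
  let ?S = "{\<tau>. 0 \<le> \<tau> \<and> log_sobolev_ineq L \<kappa> \<tau>}"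
  have ne: "?S \<noteq> {}" and bdd: "bdd_below ?S"
    using assms by (auto intro: bdd_belowI[of _ 0])
  define \<iota> where "\<iota> = Inf ?S"
  have "log_sobolev_ineq L \<kappa> \<iota>"
    unfolding log_sobolev_ineq_def
  proof (intro allI impI)
    fix f :: "(nat \<Rightarrow> nat) \<Rightarrow> real"
    assume f: "\<forall>\<omega>\<in>multislice L \<kappa>. 0 \<le> f \<omega>"
    let ?D = "dirichlet L \<kappa> (\<lambda>\<omega>. sqrt (f \<omega>)) (\<lambda>\<omega>. sqrt (f \<omega>))"
    have le: "entropy_ms L \<kappa> f \<le> \<tau> * ?D" if "\<tau> \<in> ?S" for \<tau>
      using that f by (auto simp: log_sobolev_ineq_def)
    show "entropy_ms L \<kappa> f \<le> \<iota> * ?D"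
    proof (cases "?D = 0")
      case True
      then show ?thesis using le ne by fastforce
    next
      case False
      then have D: "?D > 0" using dirichlet_self_nonneg[of L \<kappa>] by (simp add: order_less_le)
      have "entropy_ms L \<kappa> f / ?D \<le> \<iota>"
        unfolding \<iota>_def using le D by (intro cInf_greatest[OF ne]) (simp add: divide_le_eq)
      then show ?thesis using D by (simp add: divide_le_eq)
    qed
  qed
  moreover have "\<iota> \<ge> 0"
    unfolding \<iota>_def using ne by (intro cInf_greatest) auto
  ultimately show ?thesis
    unfolding tau_LS_def \<iota>_def[symmetric]
    by (intro Least_equality) (auto simp: \<iota>_def intro!: cInf_lower bdd)
qed

theorem theorem5:
  fixes L :: nat and \<kappa> :: "nat \<Rightarrow> nat"
  assumes "L \<ge> 2"
    and "\<And>l. l \<in> {1..L} \<Longrightarrow> \<kappa> l > 0"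
  shows "ln (real (msize L \<kappa>) / real (kmin L \<kappa>)) \<le> tau_LS L \<kappa> \<and>
         tau_LS L \<kappa> \<le> 4 / ln 2 * ln (real (msize L \<kappa>) / real (kmin L \<kappa>))"
proof -
  let ?\<Lambda> = "ln (real (msize L \<kappa>) / real (kmin L \<kappa>))"
  let ?S = "{\<tau>. 0 \<le> \<tau> \<and> log_sobolev_ineq L \<kappa> \<tau>}"
  have "kmin L \<kappa> > 0"
    using kmin_attained[of L \<kappa>] assms by (metis One_nat_def Suc_1 Suc_leD)
  then have "real (msize L \<kappa>) / real (kmin L \<kappa>) \<ge> 1"
    using two_kmin_le_msize[OF assms(1), of \<kappa>] by (simp add: le_divide_eq)
  then have upper: "4 / ln 2 * ?\<Lambda> \<in> ?S"
    using log_sobolev_ineq_multislice[OF assms] by simp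
  have tau: "tau_LS L \<kappa> = Inf ?S"
    using tau_LS_eq_Inf upper by blast
  have "?\<Lambda> \<le> Inf ?S"
    using upper log_sobolev_ineq_lower[OF assms] by (intro cInf_greatest) auto
  moreover have "Inf ?S \<le> 4 / ln 2 * ?\<Lambda>"
    using upper by (intro cInf_lower bdd_belowI[of _ 0]) auto
  ultimately show ?thesis
    by (simp add: tau)
qed

end
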